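(* Let $G$ be a finite digraph (loops allowed) and let $\mathcal P$ be the set of all simple cycles (primes) on $G$. Then, in $\mathbb R\langle\mathcal H\rangle$, $$ D \sum_{p \in \mathcal P} p = \sum_{H \prec G} \det( - \mathsf W_{H}) \, D\big(\mathrm{perm}(\mathsf I+ \mathsf W_{G-H})\big), $$ where the sum runs over all induced subgraphs $H$ of $G$, including the empty graph $\emptyset$ and $G$ itself.
   Context: Digraphs and edges: $G=(V(G),E(G))$ is a finite digraph with vertices $v_1,\dots,v_N$, possibly with loops. To each edge $(v_i,v_j)\in E(G)$ is attached a formal variable $\omega_{ij}$, and $\omega_{ij}:=0$ if $(v_i,v_j)\notin E(G)$. The edge variables satisfy the commutation rule $\omega_{ij}\omega_{i'j'}=\omega_{i'j'}\omega_{ij}$ whenever $i\neq i'$ (no relation is imposed between distinct edges with the same initial vertex). The labeled adjacency matrix is $\mathsf W=\mathsf W_G=(\omega_{ij})_{i,j}$. Simple cycles and hikes: a simple cycle is a closed walk $\omega_{i_0i_1}\omega_{i_1i_2}\cdots\omega_{i_{\ell-1}i_0}$ with $\ell\ge 1$ and $i_0,\dots,i_{\ell-1}$ pairwise distinct (by the commutation rule it does not depend on the starting vertex; loops have length 1, backtracks $\omega_{ij}\omega_{ji}$ length 2). The monoid $\mathcal H$ of hikes is the partially commutative (trace) monoid generated by the simple cycles of $G$, in which two simple cycles commute exactly when they are vertex-disjoint; the identity $1$ is the empty hike. Via the edge variables with the commutation rule $\omega_{ij}\omega_{i'j'}=\omega_{i'j'}\omega_{ij}$ whenever $i\neq i'$,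 hikes are identified with words in edges. The simple cycles are called primes. $V(h)$ is the set of vertices visited by the hike $h$, and $\ell(h)$ its length (number of edges with multiplicity), so $\ell(1)=0$. $\mathbb R\langle\mathcal H\rangle$ is the algebra of formal series on hikes with real coefficients, with product extending concatenation of hikes. Induced subgraphs: $H\prec G$ means $V(H)\subseteq V(G)$ and $E(H)=E(G)\cap V(H)^2$; $G-H$ is the subgraph of $G$ induced by $V(G)\setminus V(H)$. $\mathsf W_H$ is the labeled adjacency matrix of $H$ (the submatrix of $\mathsf W$ indexed by $V(H)$) and $\mathsf I$ the identity matrix of the appropriate size. Determinants and permanents are given by the usual sums over permutations (the factors of each term commute, having distinct initial vertices), and each term is a hike up to a scalar, namely the product of simple cycles given by the nontrivial choices of edges. Determinants and permanents of the empty matrix equal $1$. Derivation: $D\sum_{h\in\mathcal H} f(h)h=\sum_{h\in\mathcal H}\ell(h)f(h)h$. *)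

theory Defs
  imports
    Complex_Main
    "HOL-Combinatorics.Cycles"
    "Graph_Theory.Graph_Theory"
begin

section \<open>Partially commutative monoids\<close>

text \<open>
  \<open>trace_cong I\<close> is the congruence on words generated by \<open>ab = ba\<close> for \<open>I a b\<close>.
\<close>

definition trace_swap :: "('a \<Rightarrow> 'a \<Rightarrow> bool) \<Rightarrow> 'a list \<Rightarrow> 'a list \<Rightarrow> bool" where
  "trace_swap I u v \<longleftrightarrow> (\<exists>x a b y. I a b \<and> u = x @ [a, b] @ y \<and> v = x @ [b, a] @ y)"

definition trace_cong :: "('a \<Rightarrow> 'a \<Rightarrow> bool) \<Rightarrow> 'a list \<Rightarrow> 'a list \<Rightarrow> bool" where
  "trace_cong I = equivclp (trace_swap I)"

lemma equivp_trace_cong: "equivp (trace_cong I)"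
  unfolding trace_cong_def by (rule equivp_evquivclp)

lemma trace_cong_refl [simp, intro]: "trace_cong I u u"
  and trace_cong_sym: "trace_cong I u v \<Longrightarrow> trace_cong I v u"
  and trace_cong_trans [trans]: "trace_cong I u v \<Longrightarrow> trace_cong I v w \<Longrightarrow> trace_cong I u w"
  using equivp_trace_cong[of I] by (meson equivp_reflp equivp_symp equivp_transp)+

lemma trace_cong_swap: "I a b \<Longrightarrow> trace_cong I (x @ a # b # y) (x @ b # a # y)"
  unfolding trace_cong_def trace_swap_def by (rule r_into_equivclp) auto

text \<open>To map a trace into anything it suffices to respect single swaps.\<close>

lemma trace_cong_invariant:
  assumes "trace_cong I u v"
    and "\<And>x a b y. I a b \<Longrightarrow> f (x @ a # b # y) = f (x @ b # a # y)"
  shows "f u = f v"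
  using assms(1) unfolding trace_cong_def
proof (induction rule: equivclp_induct)
  case (step v w)
  have "f v = f w"
    using step.hyps(2) assms(2) unfolding trace_swap_def by (metis append_Cons append_Nil)
  with step.IH show ?case by simp
qed simp

lemma trace_cong_context:
  assumes "trace_cong I u v"
  shows "trace_cong I (p @ u @ q) (p @ v @ q)"
  using assms unfolding trace_cong_def
proof (induction rule: equivclp_induct)
  case base
  show ?case by (rule equivclp_refl)
next
  case (step v w)
  have "equivclp (trace_swap I) (p @ v @ q) (p @ w @ q)"
    using step.hyps(2)
  proof
    assume "trace_swap I v w"
    then obtain x a b y where "I a b" "v = x @ a # b # y" "w = x @ b # a # y"
      by (auto simp: trace_swap_def)
    then show ?thesis
      using trace_cong_swap[of I a b "p @ x" "y @ q"] by (simp add: trace_cong_def)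
  next
    assume "trace_swap I w v"
    then obtain x a b y where "I a b" "w = x @ a # b # y" "v = x @ b # a # y"
      by (auto simp: trace_swap_def)
    then show ?thesis
      using trace_cong_swap[of I a b "p @ x" "y @ q"] equivclp_sym
      by (fastforce simp: trace_cong_def)
  qed
  with step.IH show ?case by (rule equivclp_trans)
qed

lemma trace_cong_append:
  assumes "trace_cong I u u'" "trace_cong I v v'"
  shows "trace_cong I (u @ v) (u' @ v')"
proof -
  have "trace_cong I (u @ v) (u' @ v)"
    using trace_cong_context[OF assms(1), of "[]" v] by simp
  also have "trace_cong I (u' @ v) (u' @ v')"
    using trace_cong_context[OF assms(2), of u' "[]"] by simp
  finally show ?thesis .
qed

lemma trace_cong_mset: "trace_cong I u v \<Longrightarrow> mset u = mset v"
  by (rule trace_cong_invariant) auto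

lemma finite_trace_factors: "finite {(u, v). trace_cong I (u @ v) w}"
proof (rule finite_subset)
  let ?L = "{u. set u \<subseteq> set w \<and> length u \<le> length w}"
  show "{(u, v). trace_cong I (u @ v) w} \<subseteq> ?L \<times> ?L"
  proof clarify
    fix u v assume "trace_cong I (u @ v) w"
    then have "mset (u @ v) = mset w" by (rule trace_cong_mset)
    then have "set (u @ v) = set w" "length (u @ v) = length w"
      by (metis set_mset_mset, metis size_mset)
    then show "u \<in> ?L \<and> v \<in> ?L" by auto
  qed
  show "finite (?L \<times> ?L)" by (intro finite_SigmaI finite_lists_length_le) auto
qed

text \<open>Moving a letter that commutes with a whole prefix to the front.\<close>

lemma trace_cong_move_front:
  "(\<And>b. b \<in> set x \<Longrightarrow> I b a) \<Longrightarrow> trace_cong I (x @ a # y) (a # x @ y)"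
proof (induction x)
  case (Cons b x)
  have "trace_cong I (b # x @ a # y) (b # a # x @ y)"
    using trace_cong_context[OF Cons.IH, of "[b]" "[]"] Cons.prems by simp
  also have "trace_cong I (b # a # x @ y) (a # b # x @ y)"
    using trace_cong_swap[of I b a "[]"] Cons.prems by simp
  finally show ?case by simp
qed simp

lemma trace_cong_permute:
  assumes "mset u = mset v" "distinct u"
    and "\<And>a b. a \<in> set u \<Longrightarrow> b \<in> set u \<Longrightarrow> a \<noteq> b \<Longrightarrow> I a b"
  shows "trace_cong I u v"
  using assms
proof (induction v arbitrary: u)
  case (Cons a v)
  then have "a \<in> set u" by (metis list.set_intros(1) mset_eq_setD)
  then obtain x y where u: "u = x @ a # y" by (meson split_list)
  have "trace_cong I u (a # x @ y)"
    unfolding u using Cons.prems(2,3) u by (intro trace_cong_move_front) auto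
  also have "trace_cong I (x @ y) v"
    using Cons.prems u by (intro Cons.IH) auto
  then have "trace_cong I (a # x @ y) (a # v)"
    using trace_cong_context[of I "x @ y" v "[a]" "[]"] by simp
  finally show ?case .
qed simp

section \<open>Formal series with real coefficients over a monoid\<close>

class finite_factor_monoid = monoid_mult +
  assumes finite_factors: "finite {(a, b). a * b = x}"

typedef 'm series = "UNIV :: ('m \<Rightarrow> real) set"
  morphisms coeff Series by simp

setup_lifting type_definition_series

lemma series_eqI: "(\<And>h. coeff F h = coeff G h) \<Longrightarrow> F = G"
  by transfer auto

instantiation series :: (type) ab_group_add
begin
lift_definition zero_series :: "'a series" is "\<lambda>h. 0" .
lift_definition plus_series :: "'a series \<Rightarrow> 'a series \<Rightarrow> 'a series" is "\<lambda>F G h. F h + G h" .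
lift_definition minus_series :: "'a series \<Rightarrow> 'a series \<Rightarrow> 'a series" is "\<lambda>F G h. F h - G h" .
lift_definition uminus_series :: "'a series \<Rightarrow> 'a series" is "\<lambda>F h. - F h" .
instance by standard (transfer; auto)+
end

lemmas coeff_add_simps [simp] =
  zero_series.rep_eq plus_series.rep_eq minus_series.rep_eq uminus_series.rep_eq

lift_definition single :: "'m \<Rightarrow> 'm series" is "\<lambda>m h. if h = m then 1 else 0" .

lemma coeff_sum [simp]: "coeff (sum F A) h = (\<Sum>a\<in>A. coeff (F a) h)"
  by (induction A rule: infinite_finite_induct) auto

instantiation series :: (finite_factor_monoid) ring_1
begin

definition one_series :: "'a series" where "one_series = single 1"

lift_definition times_series :: "'a series \<Rightarrow> 'a series \<Rightarrow> 'a series" is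
  "\<lambda>F G h. \<Sum>(a, b) | a * b = h. F a * G b" .

instance
proof
  fix F G K :: "'a series"
  have fin2: "finite {(a, b). a * b = (h::'a)}" for h by (rule finite_factors)
  show "F * G * K = F * (G * K)"
  proof (rule series_eqI)
    fix h
    let ?P = "\<lambda>h. {(a, b). a * b = (h::'a)}"
    have "coeff (F * G * K) h =
        (\<Sum>p\<in>?P h. \<Sum>q\<in>?P (fst p). coeff F (fst q) * coeff G (snd q) * coeff K (snd p))"
      by (simp add: times_series.rep_eq case_prod_unfold sum_distrib_right)
    also have "\<dots> = (\<Sum>(p, q)\<in>(SIGMA p:?P h. ?P (fst p)).
        coeff F (fst q) * coeff G (snd q) * coeff K (snd p))"
      by (rule sum.Sigma) (auto simp: fin2)
    also have "\<dots> = (\<Sum>(p, q)\<in>(SIGMA p:?P h. ?P (snd p)).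
        coeff F (fst p) * (coeff G (fst q) * coeff K (snd q)))"
      by (rule sum.reindex_bij_witness
          [where i = "\<lambda>(p, q). ((fst p * fst q, snd q), (fst p, fst q))"
             and j = "\<lambda>(p, q). ((fst q, snd q * snd p), (snd q, snd p))"])
        (auto simp: mult.assoc)
    also have "\<dots> = (\<Sum>p\<in>?P h. \<Sum>q\<in>?P (snd p).
        coeff F (fst p) * (coeff G (fst q) * coeff K (snd q)))"
      by (rule sum.Sigma [symmetric]) (auto simp: fin2)
    also have "\<dots> = coeff (F * (G * K)) h"
      by (simp add: times_series.rep_eq case_prod_unfold sum_distrib_left)
    finally show "coeff (F * G * K) h = coeff (F * (G * K)) h" .
  qed
  show "1 * F = F"
  proof (rule series_eqI)
    fix h
    have "coeff (1 * F) h = (\<Sum>p\<in>{(a, b). a * b = h}. if p = (1, h) then coeff F h else 0)"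
      unfolding times_series.rep_eq one_series_def single.rep_eq
      by (rule sum.cong) (auto split: if_splits)
    then show "coeff (1 * F) h = coeff F h" by (simp add: sum.delta[OF fin2])
  qed
  show "F * 1 = F"
  proof (rule series_eqI)
    fix h
    have "coeff (F * 1) h = (\<Sum>p\<in>{(a, b). a * b = h}. if p = (h, 1) then coeff F h else 0)"
      unfolding times_series.rep_eq one_series_def single.rep_eq
      by (rule sum.cong) (auto split: if_splits)
    then show "coeff (F * 1) h = coeff F h" by (simp add: sum.delta[OF fin2])
  qed
  show "(F + G) * K = F * K + G * K"
    by (rule series_eqI)
      (simp add: times_series.rep_eq case_prod_unfold sum.distrib distrib_right)
  show "F * (G + K) = F * G + F * K"
    by (rule series_eqI)
      (simp add: times_series.rep_eq case_prod_unfold sum.distrib distrib_left)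
  have "coeff (0 :: 'a series) 1 \<noteq> coeff 1 1"
    by (simp add: one_series_def single.rep_eq)
  then show "(0 :: 'a series) \<noteq> 1" by metis
qed

end

section \<open>Simple cycles, edge words and hikes\<close>

text \<open>
  All types below are built from the complete digraph with loops on the vertex type;
  a particular digraph \<open>G\<close> enters through the simple cycles and the matrix entries it admits.
  The hikes on \<open>G\<close> are the hikes whose letters are simple cycles of \<open>G\<close>, so series on the
  hikes on \<open>G\<close> are the series supported on those.
\<close>

definition simple_cycle :: "('v \<times> 'v) list \<Rightarrow> bool" where
  "simple_cycle p \<longleftrightarrow> pre_digraph.cycle (with_proj \<lparr>pverts = UNIV, parcs = UNIV\<rparr>) p"

lemma pcas_iff: "p \<noteq> [] \<Longrightarrow> pcas u p v \<longleftrightarrow> u = fst (hd p) \<and> map fst p @ [v] = u # map snd p"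
proof (induction p arbitrary: u)
  case (Cons e p)
  then show ?case by (cases p) auto
qed simp

lemma pawalk_verts_tl: "pcas u p v \<Longrightarrow> tl (pawalk_verts u p) = map snd p"
proof -
  have *: "pcas u p v \<Longrightarrow> pawalk_verts u p = u # map snd p"
    by (induction p arbitrary: u) auto
  assume "pcas u p v"
  from *[OF this] show ?thesis by simp
qed

lemma cycle_iff:
  assumes "pair_wf_digraph G"
  shows "pre_digraph.cycle (with_proj G) p \<longleftrightarrow>
    p \<noteq> [] \<and> set p \<subseteq> parcs G \<and> distinct (map fst p) \<and> map snd p = rotate1 (map fst p)"
proof (cases p)
  case Nil
  then show ?thesis by (simp add: pre_digraph.cycle_def)
next
  case (Cons e q)
  interpret pair_wf_digraph G by fact
  have ne: "p \<noteq> []" using Cons by simp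
  have "pre_digraph.cycle (with_proj G) p \<longleftrightarrow>
      (\<exists>u. u \<in> pverts G \<and> set p \<subseteq> parcs G \<and> pcas u p u \<and> distinct (tl (pawalk_verts u p)))"
    using ne unfolding pre_digraph.cycle_def pre_digraph.awalk_def cas_with_proj_eq
      awalk_verts_with_proj_eq with_proj_simps by blast
  also have "\<dots> \<longleftrightarrow> (\<exists>u. u \<in> pverts G \<and> set p \<subseteq> parcs G \<and> pcas u p u \<and> distinct (map snd p))"
    by (rule arg_cong[where f = Ex], rule ext) (auto simp: pawalk_verts_tl)
  also have "\<dots> \<longleftrightarrow> fst e \<in> pverts G \<and> set p \<subseteq> parcs G \<and>
      fst e # map snd p = map fst p @ [fst e] \<and> distinct (map snd p)"
    unfolding pcas_iff[OF ne] using Cons by auto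
  also have "\<dots> \<longleftrightarrow> set p \<subseteq> parcs G \<and> map snd p = rotate1 (map fst p) \<and> distinct (map snd p)"
    using Cons arc_fst_in_verts by auto
  also have "\<dots> \<longleftrightarrow> set p \<subseteq> parcs G \<and> map snd p = rotate1 (map fst p) \<and> distinct (map fst p)"
    by (metis distinct1_rotate)
  finally show ?thesis using ne by auto
qed

lemma simple_cycle_iff:
  "simple_cycle p \<longleftrightarrow> p \<noteq> [] \<and> distinct (map fst p) \<and> map snd p = rotate1 (map fst p)"
proof -
  have "pair_wf_digraph \<lparr>pverts = UNIV, parcs = UNIV\<rparr>" by unfold_locales auto
  from cycle_iff[OF this] show ?thesis by (simp add: simple_cycle_def)
qed

lemma simple_cycle_rotate: "simple_cycle p \<Longrightarrow> simple_cycle (rotate n p)"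
proof -
  assume p: "simple_cycle p"
  then have "map snd (rotate n p) = rotate1 (map fst (rotate n p))"
    by (simp add: simple_cycle_iff rotate_map[symmetric] rotate1_rotate_swap)
  with p show ?thesis by (simp add: simple_cycle_iff rotate_map[symmetric])
qed

text \<open>Simple cycles are taken up to the choice of the starting vertex.\<close>

definition same_cycle :: "('v \<times> 'v) list \<Rightarrow> ('v \<times> 'v) list \<Rightarrow> bool" where
  "same_cycle p q \<longleftrightarrow> simple_cycle p \<and> (\<exists>n. q = rotate n p)"

quotient_type 'v prime_cycle = "('v \<times> 'v) list" / partial: same_cycle
proof (rule part_equivpI)
  have "same_cycle [(a, a)] [(a, a)]" for a :: 'v
    unfolding same_cycle_def simple_cycle_iff by (auto intro: exI[of _ 0])
  then show "\<exists>p :: ('v \<times> 'v) list. same_cycle p p" by blast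
  show "symp (same_cycle :: ('v \<times> 'v) list \<Rightarrow> _)"
  proof (rule sympI)
    fix p q :: "('v \<times> 'v) list" assume "same_cycle p q"
    then obtain n where p: "simple_cycle p" and q: "q = rotate n p"
      by (auto simp: same_cycle_def)
    have "p = rotate (length p - n mod length p) q"
      unfolding q by (metis (no_types, lifting) add.commute le_add_diff_inverse2 length_greater_0_conv
        less_or_eq_imp_le mod_less_divisor p rotate_conv_mod rotate_id mod_self rotate_rotate simple_cycle_iff)
    with p q show "same_cycle q p"
      by (auto simp: same_cycle_def simple_cycle_rotate)
  qed
  show "transp (same_cycle :: ('v \<times> 'v) list \<Rightarrow> _)"
    by (rule transpI) (auto simp: same_cycle_def rotate_rotate)
qed

lift_definition cycle_verts :: "'v prime_cycle \<Rightarrow> 'v set" is "\<lambda>p. fst ` set p"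
  by (auto simp: same_cycle_def)

lift_definition cycle_length :: "'v prime_cycle \<Rightarrow> nat" is length
  by (auto simp: same_cycle_def)

definition primes :: "'v pair_pre_digraph \<Rightarrow> 'v prime_cycle set" where
  "primes G = {abs_prime_cycle p | p. pre_digraph.cycle (with_proj G) p}"

quotient_type 'v edge_word = "('v \<times> 'v) list" / "trace_cong (\<lambda>e f. fst e \<noteq> fst f)"
  by (rule equivp_trace_cong)

lemma edge_word_cases: obtains u where "w = abs_edge_word u"
  by (rule that[of "rep_edge_word w"]) (simp add: Quotient3_abs_rep[OF Quotient3_edge_word])

instantiation edge_word :: (type) finite_factor_monoid
begin
lift_definition one_edge_word :: "'a edge_word" is "[]" .
lift_definition times_edge_word :: "'a edge_word \<Rightarrow> 'a edge_word \<Rightarrow> 'a edge_word" is "(@)"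
  by (rule trace_cong_append)
instance
proof
  fix a b c x :: "'a edge_word"
  show "a * b * c = a * (b * c)" by transfer simp
  show "1 * a = a" "a * 1 = a" by (transfer; simp)+
  obtain w where x: "x = abs_edge_word w" by (rule edge_word_cases)
  let ?I = "\<lambda>e f :: 'a \<times> 'a. fst e \<noteq> fst f"
  have "{(a, b). a * b = x} \<subseteq> map_prod abs_edge_word abs_edge_word ` {(u, v). trace_cong ?I (u @ v) w}"
  proof
    fix z assume "z \<in> {(a, b). a * b = x}"
    then obtain a b where z: "z = (a, b)" and ab: "a * b = x" by blast
    obtain u where u: "a = abs_edge_word u" by (rule edge_word_cases)
    obtain v where v: "b = abs_edge_word v" by (rule edge_word_cases)
    note uv = u v
    have "trace_cong ?I (u @ v) w"
      using ab unfolding x uv times_edge_word.abs_eq edge_word.abs_eq_iff .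
    then show "z \<in> map_prod abs_edge_word abs_edge_word ` {(u, v). trace_cong ?I (u @ v) w}"
      unfolding z uv by (intro image_eqI[of _ _ "(u, v)"]) simp_all
  qed
  then show "finite {(a, b). a * b = x}"
    by (rule finite_subset) (intro finite_imageI finite_trace_factors)
qed
end

lift_definition edge :: "'v \<Rightarrow> 'v \<Rightarrow> 'v edge_word" is "\<lambda>i j. [(i, j)]" .

lemma mset_rotate [simp]: "mset (rotate n p) = mset p"
  by (metis append_take_drop_id mset_append rotate_drop_take union_commute)

lift_definition cycle_word :: "'v prime_cycle \<Rightarrow> 'v edge_word" is "\<lambda>p. p"
proof -
  fix p q :: "('v \<times> 'v) list" assume "same_cycle p q"
  then have "simple_cycle p" "mset p = mset q"
    by (auto simp: same_cycle_def)
  then show "trace_cong (\<lambda>e f. fst e \<noteq> fst f) p q"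
    by (intro trace_cong_permute)
      (auto simp: simple_cycle_iff distinct_map inj_on_def)
qed

lemma cycle_word_commute:
  assumes "cycle_verts c \<inter> cycle_verts d = {}"
  shows "cycle_word c * cycle_word d = cycle_word d * cycle_word c"
  using assms
proof transfer
  fix p q :: "('v \<times> 'v) list"
  assume "same_cycle p p" "same_cycle q q" and dj: "fst ` set p \<inter> fst ` set q = {}"
  then have "simple_cycle p" "simple_cycle q" by (auto simp: same_cycle_def)
  with dj show "trace_cong (\<lambda>e f. fst e \<noteq> fst f) (p @ q) (q @ p)"
    by (intro trace_cong_permute)
      (auto simp: simple_cycle_iff distinct_map inj_on_def)
qed

(* keeps lift_definition on hikes from descending to lists of lists of arcs *)
lifting_forget prime_cycle.lifting
lifting_forget edge_word.lifting

quotient_type 'v hike =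
  "'v prime_cycle list" / "trace_cong (\<lambda>c d. cycle_verts c \<inter> cycle_verts d = {})"
  by (rule equivp_trace_cong)

lemma hike_cases: obtains cs where "h = abs_hike cs"
  by (rule that[of "rep_hike h"]) (simp add: Quotient3_abs_rep[OF Quotient3_hike])

instantiation hike :: (type) finite_factor_monoid
begin
lift_definition one_hike :: "'a hike" is "[]" .
lift_definition times_hike :: "'a hike \<Rightarrow> 'a hike \<Rightarrow> 'a hike" is "(@)"
  by (rule trace_cong_append)
instance
proof
  fix a b c x :: "'a hike"
  show "a * b * c = a * (b * c)" by transfer simp
  show "1 * a = a" "a * 1 = a" by (transfer; simp)+
  let ?I = "\<lambda>c d :: 'a prime_cycle. cycle_verts c \<inter> cycle_verts d = {}"
  obtain w where x: "x = abs_hike w" by (rule hike_cases)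
  have "{(a, b). a * b = x} \<subseteq> map_prod abs_hike abs_hike ` {(u, v). trace_cong ?I (u @ v) w}"
  proof
    fix z assume "z \<in> {(a, b). a * b = x}"
    then obtain a b where z: "z = (a, b)" and ab: "a * b = x" by blast
    obtain u where u: "a = abs_hike u" by (rule hike_cases)
    obtain v where v: "b = abs_hike v" by (rule hike_cases)
    note uv = u v
    have "trace_cong ?I (u @ v) w"
      using ab unfolding x uv times_hike.abs_eq hike.abs_eq_iff .
    then show "z \<in> map_prod abs_hike abs_hike ` {(u, v). trace_cong ?I (u @ v) w}"
      unfolding z uv by (intro image_eqI[of _ _ "(u, v)"]) simp_all
  qed
  then show "finite {(a, b). a * b = x}"
    by (rule finite_subset) (intro finite_imageI finite_trace_factors)
qed
end

lift_definition prime_hike :: "'v prime_cycle \<Rightarrow> 'v hike" is "\<lambda>c. [c]" .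

lift_definition hike_length :: "'v hike \<Rightarrow> nat" is "\<lambda>cs. sum_list (map cycle_length cs)"
  by (erule trace_cong_invariant) auto

lift_definition hike_word :: "'v hike \<Rightarrow> 'v edge_word" is "\<lambda>cs. prod_list (map cycle_word cs)"
proof (erule trace_cong_invariant)
  fix x y :: "'v prime_cycle list" and a b :: "'v prime_cycle"
  assume "cycle_verts a \<inter> cycle_verts b = {}"
  then have "cycle_word a * (cycle_word b * z) = cycle_word b * (cycle_word a * z)" for z
    by (metis cycle_word_commute mult.assoc)
  then show "prod_list (map cycle_word (x @ a # b # y)) = prod_list (map cycle_word (x @ b # a # y))"
    by simp
qed

lemma hike_word_1 [simp]: "hike_word 1 = 1"
  by transfer simp

lemma hike_word_mult [simp]: "hike_word (g * h) = hike_word g * hike_word h"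
  by transfer simp

lemma hike_word_prime [simp]: "hike_word (prime_hike c) = cycle_word c"
  by transfer simp

section \<open>The identification of hikes with edge words\<close>

text \<open>\<open>hike_word\<close> is injective: a hike is determined by the words of successors at each vertex.\<close>

definition succs :: "('v \<times> 'v) list \<Rightarrow> 'v \<Rightarrow> 'v list" where
  "succs w v = map snd (filter (\<lambda>e. fst e = v) w)"

definition word_succs :: "'v edge_word \<Rightarrow> 'v \<Rightarrow> 'v list" where
  "word_succs w = succs (rep_edge_word w)"

lemma succs_append [simp]: "succs (u @ w) v = succs u v @ succs w v"
  by (simp add: succs_def)

lemma succs_cong: "trace_cong (\<lambda>e f. fst e \<noteq> fst f) u w \<Longrightarrow> succs u = succs w"
  by (erule trace_cong_invariant) (auto simp: succs_def fun_eq_iff)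

lemma word_succs_abs [simp]: "word_succs (abs_edge_word w) = succs w"
  unfolding word_succs_def
  by (rule succs_cong) (simp add: Quotient3_edge_word Quotient3_rep_abs equivp_reflp)

lemma prime_cycle_cases: obtains p where "c = abs_prime_cycle p" "simple_cycle p"
proof -
  have "c = abs_prime_cycle (rep_prime_cycle c)" "same_cycle (rep_prime_cycle c) (rep_prime_cycle c)"
    by (metis Quotient3_abs_rep Quotient3_prime_cycle,
        metis Quotient3_prime_cycle Quotient3_rep_reflp)
  then show ?thesis using that by (auto simp: same_cycle_def)
qed

lemma same_cycle_refl: "simple_cycle p \<Longrightarrow> same_cycle p p"
  by (auto simp: same_cycle_def intro: exI[of _ 0])

lemma word_succs_mult [simp]: "word_succs (a * b) v = word_succs a v @ word_succs b v"
  by (rule edge_word_cases[of a], rule edge_word_cases[of b]) (simp add: times_edge_word.abs_eq)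

lemma word_succs_1 [simp]: "word_succs 1 v = []"
  by (simp add: one_edge_word_def succs_def)

lemma word_succs_cycle:
  "simple_cycle p \<Longrightarrow> word_succs (cycle_word (abs_prime_cycle p)) = succs p"
  by (simp add: cycle_word.abs_eq same_cycle_refl)

lemma cycle_verts_abs:
  "simple_cycle p \<Longrightarrow> cycle_verts (abs_prime_cycle p) = fst ` set p"
  by (simp add: cycle_verts.abs_eq same_cycle_refl)

lemma succs_distinct:
  assumes "distinct (map fst p)" "(v, u) \<in> set p"
  shows "succs p v = [u]"
  using assms by (induction p) (force simp: succs_def filter_empty_conv)+

lemma succs_notin: "v \<notin> fst ` set p \<Longrightarrow> succs p v = []"
  by (force simp: succs_def filter_empty_conv)

lemma simple_cycle_next:
  assumes "simple_cycle p" "i < length p"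
  shows "snd (p ! i) = fst (p ! (Suc i mod length p))"
proof -
  have "snd (p ! i) = map snd p ! i" using assms by simp
  also have "\<dots> = map fst p ! (Suc i mod length p)"
    using assms by (simp add: simple_cycle_iff nth_rotate1)
  finally show ?thesis using assms by (simp add: simple_cycle_iff)
qed

lemma simple_cycle_agree:
  assumes p: "simple_cycle p" and q: "simple_cycle q"
    and start: "fst (p ! 0) = fst (q ! 0)"
    and agree: "\<And>v x y. (v, x) \<in> set p \<Longrightarrow> (v, y) \<in> set q \<Longrightarrow> x = y"
    and le: "length p \<le> length q"
  shows "p = q"
proof -
  have pos: "0 < length p" "0 < length q" using p q by (auto simp: simple_cycle_iff)
  have step: "p ! i = q ! i" if "i < length p" "fst (p ! i) = fst (q ! i)" for i
  proof -
    have "p ! i \<in> set p" "q ! i \<in> set q" using that le by auto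
    then have "(fst (p ! i), snd (p ! i)) \<in> set p" "(fst (p ! i), snd (q ! i)) \<in> set q"
      by (simp only: prod.collapse, simp only: that(2) prod.collapse)
    then have "snd (p ! i) = snd (q ! i)" by (rule agree)
    with that(2) show ?thesis by (rule prod_eqI)
  qed
  have eq: "i < length p \<Longrightarrow> p ! i = q ! i" for i
  proof (induction i)
    case 0
    then show ?case using step start by simp
  next
    case (Suc i)
    have "fst (p ! Suc i) = snd (p ! i)"
      using simple_cycle_next[OF p, of i] Suc.prems by simp
    also have "\<dots> = snd (q ! i)" using Suc by simp
    also have "\<dots> = fst (q ! Suc i)"
      using simple_cycle_next[OF q, of i] Suc.prems le by simp
    finally show ?case using step Suc.prems by blast
  qed
  have "length p = length q"
  proof (rule ccontr)
    assume "length p \<noteq> length q"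
    with le have lt: "length p < length q" by simp
    define n where "n = length p - 1"
    have n: "n < length p" "Suc n = length p" using pos by (auto simp: n_def)
    have "fst (q ! length p) = snd (q ! n)"
      using simple_cycle_next[OF q, of n] n lt by simp
    also have "\<dots> = snd (p ! n)" using eq n by simp
    also have "\<dots> = fst (q ! 0)"
      using simple_cycle_next[OF p, of n] n start by simp
    finally have "map fst q ! length p = map fst q ! 0" using lt pos by simp
    then have "length p = 0"
      using q lt pos nth_eq_iff_index_eq[of "map fst q" "length p" 0]
      by (simp add: simple_cycle_iff)
    with pos show False by simp
  qed
  with eq show ?thesis by (auto intro: nth_equalityI)
qed

lemma rotate_to_front:
  assumes "v \<in> fst ` set p"
  obtains n where "fst (rotate n p ! 0) = v"
proof -
  from assms obtain i where i: "i < length p" "fst (p ! i) = v"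
    by (auto simp: in_set_conv_nth image_iff)
  then have "rotate i p ! 0 = p ! i" by (subst nth_rotate) auto
  with i that show ?thesis by metis
qed

lemma prime_cycle_agree:
  assumes meet: "cycle_verts c \<inter> cycle_verts d \<noteq> {}"
    and agree: "\<And>v. v \<in> cycle_verts c \<Longrightarrow> v \<in> cycle_verts d \<Longrightarrow>
      word_succs (cycle_word c) v = word_succs (cycle_word d) v"
  shows "c = d"
proof -
  obtain p where p: "c = abs_prime_cycle p" "simple_cycle p" by (rule prime_cycle_cases)
  obtain q where q: "d = abs_prime_cycle q" "simple_cycle q" by (rule prime_cycle_cases)
  from meet obtain v where v: "v \<in> fst ` set p" "v \<in> fst ` set q"
    using p q by (auto simp: cycle_verts_abs)
  obtain m where m: "fst (rotate m p ! 0) = v" using v(1) by (rule rotate_to_front)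
  obtain n where n: "fst (rotate n q ! 0) = v" using v(2) by (rule rotate_to_front)
  have ag: "x = y" if "(u, x) \<in> set p" "(u, y) \<in> set q" for u x y
  proof -
    have "u \<in> fst ` set p" "u \<in> fst ` set q" using that by force+
    then have "succs p u = succs q u"
      using agree[of u] p q by (simp add: cycle_verts_abs word_succs_cycle)
    then show ?thesis
      using that p q by (simp add: succs_distinct simple_cycle_iff)
  qed
  have "rotate m p = rotate n q"
  proof (cases "length p \<le> length q")
    case True
    show ?thesis
      by (rule simple_cycle_agree) (use True p q m n ag in \<open>auto simp: simple_cycle_rotate\<close>)
  next
    case False
    have "rotate n q = rotate m p"
      by (rule simple_cycle_agree) (use False p q m n ag in \<open>auto simp: simple_cycle_rotate\<close>)
    then show ?thesis ..
  qed
  moreover have "c = abs_prime_cycle (rotate m p)"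
    unfolding p(1) by (rule Quotient3_rel_abs[OF Quotient3_prime_cycle])
      (use p in \<open>auto simp: same_cycle_def\<close>)
  moreover have "d = abs_prime_cycle (rotate n q)"
    unfolding q(1) by (rule Quotient3_rel_abs[OF Quotient3_prime_cycle])
      (use q in \<open>auto simp: same_cycle_def\<close>)
  ultimately show ?thesis by simp
qed

lemma cycle_succs_cases:
  shows cycle_succs_in: "v \<in> cycle_verts c \<Longrightarrow> \<exists>u. word_succs (cycle_word c) v = [u]"
    and cycle_succs_notin: "v \<notin> cycle_verts c \<Longrightarrow> word_succs (cycle_word c) v = []"
    and cycle_verts_nonempty: "cycle_verts c \<noteq> {}"
proof -
  obtain p where p: "c = abs_prime_cycle p" "simple_cycle p" by (rule prime_cycle_cases)
  show "\<exists>u. word_succs (cycle_word c) v = [u]" if "v \<in> cycle_verts c"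
  proof -
    from that obtain u where "(v, u) \<in> set p" using p by (auto simp: cycle_verts_abs)
    then show ?thesis using p by (auto simp: word_succs_cycle simple_cycle_iff succs_distinct)
  qed
  show "v \<notin> cycle_verts c \<Longrightarrow> word_succs (cycle_word c) v = []"
    using p by (simp add: word_succs_cycle cycle_verts_abs succs_notin)
  show "cycle_verts c \<noteq> {}" using p by (simp add: cycle_verts_abs simple_cycle_iff)
qed

lemma cycle_list_cong:
  assumes "\<And>v. word_succs (prod_list (map cycle_word cs)) v = word_succs (prod_list (map cycle_word ds)) v"
  shows "trace_cong (\<lambda>c d. cycle_verts c \<inter> cycle_verts d = {}) cs ds"
  using assms
proof (induction cs arbitrary: ds)
  case Nil
  show ?case
  proof (cases ds)
    case (Cons d ds')
    obtain v where v: "v \<in> cycle_verts d" using cycle_verts_nonempty[of d] by auto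
    obtain u where "word_succs (cycle_word d) v = [u]" using cycle_succs_in[OF v] by (elim exE)
    with Nil[of v] Cons show ?thesis by simp
  qed simp
next
  case (Cons c cs)
  let ?S = "\<lambda>cs. word_succs (prod_list (map cycle_word cs))"
  have notin: "?S x v = []" if "\<forall>b\<in>set x. v \<notin> cycle_verts b" for x v
    using that by (induction x) (auto simp: cycle_succs_notin)
  obtain v where v: "v \<in> cycle_verts c" using cycle_verts_nonempty[of c] by auto
  have "?S ds v \<noteq> []"
    using Cons.prems[of v] cycle_succs_in[OF v] by auto
  then have "\<exists>d\<in>set ds. cycle_verts d \<inter> cycle_verts c \<noteq> {}"
    using notin[of ds v] v by (meson disjoint_iff)
  from split_list_first_prop[OF this] obtain x d y where ds: "ds = x @ d # y"
    and d: "cycle_verts d \<inter> cycle_verts c \<noteq> {}"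
    and x: "\<forall>b\<in>set x. \<not> cycle_verts b \<inter> cycle_verts c \<noteq> {}"
    by (elim exE conjE)
  have xv: "?S x v = []" if "v \<in> cycle_verts c" for v
    by (rule notin) (use that x in fast)
  have "c = d"
  proof (rule prime_cycle_agree)
    show "cycle_verts c \<inter> cycle_verts d \<noteq> {}" using d by auto
    fix v assume v: "v \<in> cycle_verts c" "v \<in> cycle_verts d"
    obtain s t where "word_succs (cycle_word c) v = [s]" "word_succs (cycle_word d) v = [t]"
      using cycle_succs_in[OF v(1)] cycle_succs_in[OF v(2)] by (elim exE)
    with Cons.prems[of v] show "word_succs (cycle_word c) v = word_succs (cycle_word d) v"
      by (simp add: ds xv[OF v(1)])
  qed
  have "?S cs v = ?S (x @ y) v" for v
  proof (cases "v \<in> cycle_verts c")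
    case True
    then show ?thesis using Cons.prems[of v] \<open>c = d\<close> by (simp add: ds xv)
  next
    case False
    then show ?thesis using Cons.prems[of v] \<open>c = d\<close> by (simp add: ds cycle_succs_notin)
  qed
  then have "trace_cong (\<lambda>c d. cycle_verts c \<inter> cycle_verts d = {}) cs (x @ y)"
    by (rule Cons.IH)
  then have "trace_cong (\<lambda>c d. cycle_verts c \<inter> cycle_verts d = {}) (c # cs) (c # x @ y)"
    using trace_cong_context[of _ cs "x @ y" "[c]" "[]"] by simp
  also have "trace_cong (\<lambda>c d. cycle_verts c \<inter> cycle_verts d = {}) (c # x @ y) ds"
    unfolding ds \<open>c = d\<close>[symmetric] using x
    by (intro trace_cong_sym[OF trace_cong_move_front]) auto
  finally show ?case .
qed

theorem inj_hike_word: "inj hike_word"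
proof (rule injI)
  fix g h :: "'v hike" assume eq: "hike_word g = hike_word h"
  obtain cs where g: "g = abs_hike cs" by (rule hike_cases)
  obtain ds where h: "h = abs_hike ds" by (rule hike_cases)
  from eq show "g = h"
    unfolding g h hike.abs_eq_iff by (intro cycle_list_cong) (simp add: hike_word.abs_eq)
qed

text \<open>
  Restricting a series on edge words to hikes along the injection \<open>hike_word\<close>. Nothing is lost
  on the series to which this is applied below: see \<open>ncdet_hikes\<close> and \<open>ncperm_hikes\<close>.
\<close>

definition hike_series :: "'v edge_word series \<Rightarrow> 'v hike series" where
  "hike_series F = Series (\<lambda>h. coeff F (hike_word h))"

section \<open>Derivation, determinants and permanents\<close>

definition derivation :: "'v hike series \<Rightarrow> 'v hike series" where
  "derivation F = Series (\<lambda>h. real (hike_length h) * coeff F h)"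

text \<open>
  Rows and columns are indexed by a finite set \<open>S\<close>. The product over \<open>S\<close> is taken in increasing
  order of rows; for the matrices considered here entries in different rows commute.
\<close>

definition ncdet :: "'i::linorder set \<Rightarrow> ('i \<Rightarrow> 'i \<Rightarrow> 'r::ring_1) \<Rightarrow> 'r" where
  "ncdet S A = (\<Sum>\<sigma> | \<sigma> permutes S.
     of_int (sign \<sigma>) * prod_list (map (\<lambda>i. A i (\<sigma> i)) (sorted_list_of_set S)))"

definition ncperm :: "'i::linorder set \<Rightarrow> ('i \<Rightarrow> 'i \<Rightarrow> 'r::ring_1) \<Rightarrow> 'r" where
  "ncperm S A = (\<Sum>\<sigma> | \<sigma> permutes S. prod_list (map (\<lambda>i. A i (\<sigma> i)) (sorted_list_of_set S)))"

definition id_matrix :: "'i \<Rightarrow> 'i \<Rightarrow> 'r::ring_1" where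
  "id_matrix i j = (if i = j then 1 else 0)"

definition adj_matrix :: "('v, 'v \<times> 'v) pre_digraph \<Rightarrow> 'v \<Rightarrow> 'v \<Rightarrow> 'v edge_word series" where
  "adj_matrix G i j = (if i \<rightarrow>\<^bsub>G\<^esub> j then single (edge i j) else 0)"

lemma prod_list_edges:
  "prod_list (map (\<lambda>i. edge i (f i)) xs) = abs_edge_word (map (\<lambda>i. (i, f i)) xs)"
  by (induction xs) (simp_all add: one_edge_word_def edge.abs_eq times_edge_word.abs_eq)

lemma permutation_word_hike:
  assumes "finite S" "\<sigma> permutes S" "distinct xs" "set xs = S"
  shows "prod_list (map (\<lambda>i. edge i (\<sigma> i)) xs) \<in> range hike_word"
  using assms
proof (induction "card S" arbitrary: S \<sigma> xs rule: less_induct)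
  case less
  show ?case
  proof (cases "S = {}")
    case True
    then have "prod_list (map (\<lambda>i. edge i (\<sigma> i)) xs) = hike_word 1" using less.prems by simp
    then show ?thesis by blast
  next
    case False
    then obtain a where a: "a \<in> S" by blast
    have perm: "permutation \<sigma>" using less.prems by (metis permutation_permutes)
    define c where "c = support \<sigma> a"
    define n where "n = least_power \<sigma> a"
    have c: "c = map (\<lambda>k. (\<sigma> ^^ k) a) [0..<n]" by (simp add: c_def n_def)
    have n: "(\<sigma> ^^ n) a = a" "n > 0"
      using least_power_of_permutation[OF perm] by (auto simp: n_def)
    have "distinct c" using cycle_of_permutation[OF perm, of a] by (simp add: c_def)
    have rot: "map \<sigma> c = rotate1 c"
    proof (rule nth_equalityI)
      fix i assume "i < length (map \<sigma> c)"
      then have i: "i < n" by (simp add: c)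
      have "rotate1 c ! i = (\<sigma> ^^ (Suc i mod n)) a"
        using i by (simp add: c nth_rotate1)
      also have "\<dots> = (\<sigma> ^^ Suc i) a"
        using i n by (cases "Suc i = n") auto
      finally show "map \<sigma> c ! i = rotate1 c ! i" using i by (simp add: c)
    qed simp
    define p where "p = map (\<lambda>i. (i, \<sigma> i)) c"
    have "simple_cycle p"
      using \<open>distinct c\<close> rot n by (auto simp: simple_cycle_iff p_def c comp_def)
    have in_S: "(\<sigma> ^^ k) a \<in> S" for k
      using a less.prems(2) by (induction k) (auto simp: permutes_in_image)
    then have "set c \<subseteq> S" by (auto simp: c)
    have im: "\<sigma> ` set c = set c" using rot by (metis set_map set_rotate1)
    define T where "T = S - set c"
    define \<tau> where "\<tau> = (\<lambda>i. if i \<in> T then \<sigma> i else i)"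
    have inj: "inj \<sigma>" using less.prems(2) by (rule permutes_inj)
    have "\<sigma> ` S = S" using less.prems(2) by (rule permutes_image)
    then have "\<sigma> ` T = T" using im inj by (simp add: T_def image_set_diff)
    then have "bij_betw \<tau> T T"
      using inj by (auto simp: bij_betw_def \<tau>_def inj_on_def inj_def image_iff)
    then have "\<tau> permutes T" by (rule bij_imp_permutes) (simp add: \<tau>_def)
    obtain ys where ys: "set ys = T" "distinct ys"
      using finite_distinct_list[of T] less.prems(1) by (auto simp: T_def)
    have "a \<in> set c" using n by (auto simp: c intro: image_eqI[of _ _ 0])
    then have "T \<subset> S" using a by (auto simp: T_def)
    then have "card T < card S" using less.prems(1) by (rule psubset_card_mono[rotated])
    then have "prod_list (map (\<lambda>i. edge i (\<tau> i)) ys) \<in> range hike_word"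
      using less.hyps[of T \<tau> ys] less.prems(1) ys \<open>\<tau> permutes T\<close> by (simp add: T_def)
    then obtain h where h: "prod_list (map (\<lambda>i. edge i (\<tau> i)) ys) = hike_word h" by blast
    have \<tau>: "map (\<lambda>i. (i, \<tau> i)) ys = map (\<lambda>i. (i, \<sigma> i)) ys"
      using ys by (auto simp: \<tau>_def)
    have "mset xs = mset (c @ ys)"
      using less.prems \<open>distinct c\<close> ys \<open>set c \<subseteq> S\<close>
      by (subst set_eq_iff_mset_eq_distinct[symmetric]) (auto simp: T_def)
    then have "mset (map (\<lambda>i. (i, \<sigma> i)) xs) = mset (map (\<lambda>i. (i, \<sigma> i)) (c @ ys))"
      by (metis mset_map)
    then have "trace_cong (\<lambda>e f. fst e \<noteq> fst f) (map (\<lambda>i. (i, \<sigma> i)) xs)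
        (map (\<lambda>i. (i, \<sigma> i)) (c @ ys))"
      using less.prems by (intro trace_cong_permute) (auto simp: distinct_map inj_on_def)
    then have "prod_list (map (\<lambda>i. edge i (\<sigma> i)) xs) =
        abs_edge_word (map (\<lambda>i. (i, \<sigma> i)) (c @ ys))"
      by (simp add: prod_list_edges edge_word.abs_eq_iff)
    also have "\<dots> = abs_edge_word p * abs_edge_word (map (\<lambda>i. (i, \<tau> i)) ys)"
      by (simp add: times_edge_word.abs_eq p_def \<tau>)
    also have "\<dots> = hike_word (prime_hike (abs_prime_cycle p) * h)"
      using h \<open>simple_cycle p\<close> by (simp add: cycle_word.abs_eq same_cycle_refl prod_list_edges)
    finally show ?thesis by blast
  qed
qed

lemma coeff_prod_list_nonzero:
  "coeff (prod_list Fs) w \<noteq> 0 \<Longrightarrow> \<exists>ws. list_all2 (\<lambda>F u. coeff F u \<noteq> 0) Fs ws \<and> w = prod_list ws"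
proof (induction Fs arbitrary: w)
  case Nil
  then have "w = 1" by (simp add: one_series_def single.rep_eq split: if_splits)
  then show ?case by simp
next
  case (Cons F Fs)
  then have "(\<Sum>(a, b) | a * b = w. coeff F a * coeff (prod_list Fs) b) \<noteq> 0"
    by (simp add: times_series.rep_eq)
  then obtain a b where "a * b = w" "coeff F a \<noteq> 0" "coeff (prod_list Fs) b \<noteq> 0"
    by (force elim!: sum.not_neutral_contains_not_neutral)
  moreover from Cons.IH[OF this(3)] obtain ws where
    "list_all2 (\<lambda>F u. coeff F u \<noteq> 0) Fs ws" "b = prod_list ws" by blast
  ultimately show ?case by (intro exI[of _ "a # ws"]) simp
qed

text \<open>The terms of the determinant and permanent expansions are hikes.\<close>

lemma permutation_term_hike:
  fixes A :: "'v::linorder \<Rightarrow> 'v \<Rightarrow> 'v edge_word series"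
  assumes S: "finite S" "\<sigma> permutes S"
    and A: "\<And>i j u. coeff (A i j) u \<noteq> 0 \<Longrightarrow> u = edge i j \<or> i = j \<and> u = 1"
    and w: "coeff (prod_list (map (\<lambda>i. A i (\<sigma> i)) (sorted_list_of_set S))) w \<noteq> 0"
  shows "w \<in> range hike_word"
proof -
  have *: "\<exists>ys. distinct ys \<and> set ys \<subseteq> set xs \<and> (\<forall>i\<in>set xs - set ys. \<sigma> i = i) \<and>
      prod_list ws = prod_list (map (\<lambda>i. edge i (\<sigma> i)) ys)"
    if "list_all2 (\<lambda>F u. coeff F u \<noteq> 0) (map (\<lambda>i. A i (\<sigma> i)) xs) ws" "distinct xs" for xs ws
    using that
  proof (induction xs arbitrary: ws)
    case (Cons i xs)
    then obtain u us where ws: "ws = u # us" and u: "coeff (A i (\<sigma> i)) u \<noteq> 0"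
      and us: "list_all2 (\<lambda>F u. coeff F u \<noteq> 0) (map (\<lambda>i. A i (\<sigma> i)) xs) us"
      by (auto simp: list_all2_Cons1)
    from Cons.IH[OF us] Cons.prems obtain ys where ys: "distinct ys" "set ys \<subseteq> set xs"
      "\<forall>i\<in>set xs - set ys. \<sigma> i = i" "prod_list us = prod_list (map (\<lambda>i. edge i (\<sigma> i)) ys)"
      by auto
    from A[OF u] show ?case
    proof
      assume "u = edge i (\<sigma> i)"
      with ys Cons.prems show ?thesis by (intro exI[of _ "i # ys"]) (auto simp: ws)
    next
      assume "i = \<sigma> i \<and> u = 1"
      with ys Cons.prems show ?thesis by (intro exI[of _ ys]) (auto simp: ws)
    qed
  qed simp
  from coeff_prod_list_nonzero[OF w] obtain ws where
    ws: "list_all2 (\<lambda>F u. coeff F u \<noteq> 0) (map (\<lambda>i. A i (\<sigma> i)) (sorted_list_of_set S)) ws"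
    "w = prod_list ws" by blast
  from *[OF ws(1)] S(1) obtain ys where ys: "distinct ys" "set ys \<subseteq> S"
    "\<forall>i\<in>S - set ys. \<sigma> i = i" "w = prod_list (map (\<lambda>i. edge i (\<sigma> i)) ys)"
    using ws(2) by auto
  have "\<sigma> permutes set ys"
    using S(2) ys(2,3) unfolding permutes_def by blast
  then show ?thesis
    using permutation_word_hike[of "set ys" \<sigma> ys] ys by simp
qed

lemma ncperm_hikes:
  assumes "finite S" "coeff (ncperm S (\<lambda>i j. id_matrix i j + adj_matrix G i j)) w \<noteq> 0"
  shows "w \<in> range hike_word"
proof -
  obtain \<sigma> where \<sigma>: "\<sigma> permutes S" and w: "coeff (prod_list
      (map (\<lambda>i. id_matrix i (\<sigma> i) + adj_matrix G i (\<sigma> i)) (sorted_list_of_set S))) w \<noteq> 0"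
    using assms(2) unfolding ncperm_def coeff_sum
    by (auto elim!: sum.not_neutral_contains_not_neutral)
  show ?thesis
    by (rule permutation_term_hike[where A = "\<lambda>i j. id_matrix i j + adj_matrix G i j",
          OF assms(1) \<sigma> _ w])
      (auto simp: id_matrix_def adj_matrix_def one_series_def single.rep_eq split: if_splits)
qed

lemma ncdet_hikes:
  assumes "finite S" "coeff (ncdet S (\<lambda>i j. - adj_matrix G i j)) w \<noteq> 0"
  shows "w \<in> range hike_word"
proof -
  obtain \<sigma> where \<sigma>: "\<sigma> permutes S" and w: "coeff (of_int (sign \<sigma>) * prod_list
      (map (\<lambda>i. - adj_matrix G i (\<sigma> i)) (sorted_list_of_set S))) w \<noteq> 0"
    using assms(2) unfolding ncdet_def coeff_sum
    by (auto elim!: sum.not_neutral_contains_not_neutral)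
  have "coeff (prod_list (map (\<lambda>i. - adj_matrix G i (\<sigma> i)) (sorted_list_of_set S))) w \<noteq> 0"
    using w by (auto simp: sign_def split: if_splits)
  then show ?thesis
    by (rule permutation_term_hike[where A = "\<lambda>i j. - adj_matrix G i j",
          OF assms(1) \<sigma>, rotated])
      (auto simp: adj_matrix_def single.rep_eq split: if_splits)
qed

lemma finite_primes:
  assumes "pair_fin_digraph G"
  shows "finite (primes G)"
proof -
  interpret pair_fin_digraph G by fact
  have "{p. pre_digraph.cycle (with_proj G) p} \<subseteq> {p. set p \<subseteq> parcs G \<and> distinct p}"
    using cycle_iff[OF pair_wf_digraph_axioms] by (auto simp: distinct_map)
  then have "finite {p. pre_digraph.cycle (with_proj G) p}"
    by (rule finite_subset) (rule finite_subset_distinct[OF pair_finite_arcs])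
  then show ?thesis by (simp add: primes_def setcompr_eq_image)
qed

lemma finite_induced_subgraphs:
  assumes "pair_fin_digraph G"
  shows "finite {H. induced_subgraph H (with_proj G)}"
proof -
  interpret pair_fin_digraph G by fact
  have "H = with_proj G \<restriction> verts H \<and> verts H \<subseteq> pverts G" if "induced_subgraph H (with_proj G)" for H
    using that by (auto simp: induced_subgraph_def subgraph_def compatible_def induce_subgraph_def)
  then have "{H. induced_subgraph H (with_proj G)} \<subseteq> (\<lambda>U. with_proj G \<restriction> U) ` Pow (pverts G)"
    by blast
  then show ?thesis by (rule finite_subset) (simp add: pair_finite_verts)
qed

end

theory Submission
  imports Defs
begin

text \<open>
  A finite family \<open>P\<close> of pairwise vertex-disjoint simple cycles has a well-defined product hike
  \<open>h(P)\<close>, its members commuting. Such families are the same thing as permutations along the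
  arcs: the family with vertex set \<open>S\<close> corresponds to the permutation of \<open>S\<close> that moves every
  vertex to its successor, loops being the fixed points (\<open>bij_betw_family_perm\<close>). A cycle of length
  \<open>\<ell>\<close> contributes \<open>(- 1) ^ (\<ell> - 1)\<close> to the sign of the permutation and \<open>(- 1) ^ \<ell>\<close> to the sign
  of the entries of \<open>- W\<close>, that is, \<open>- 1\<close> in total. Hence \<open>det (- W)\<close> on the vertex set \<open>S\<close> is the
  sum of \<open>(- 1) ^ |A| h(A)\<close> over the families \<open>A\<close> with vertex set exactly \<open>S\<close> (\<open>hike_series_ncdet\<close>).
  In \<open>perm (I + W)\<close> a vertex may also be left out at the price of a factor \<open>1\<close>, so that on \<open>S\<close> it is
  the sum of \<open>h(B)\<close> over the families \<open>B\<close> with vertex set contained in \<open>S\<close>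
  (\<open>hike_series_ncperm\<close>).
  
  Therefore the right-hand side of the theorem is the sum of \<open>(- 1) ^ |A| \<ell>(B) h(A) h(B)\<close> over all
  pairs of families without a common vertex. Such a pair is a family \<open>P = A \<union> B\<close> with a chosen subset
  \<open>A\<close>, and \<open>h(A) h(B) = h(P)\<close>. As \<open>\<ell>\<close> is additive, the coefficient of \<open>h(P)\<close> is
  \<open>(\<Sum>c\<in>P. \<ell>(c) * (\<Sum>A\<in>Pow (P - {c}). (- 1) ^ card A))\<close>. The inner alternating sum vanishes
  unless \<open>P = {c}\<close>, so only the single primes survive, each with its length as coefficient
  (\<open>splitting_cancellation\<close>).
\<close>

section \<open>Simple cycles as cyclic permutations\<close>

definition successor :: "'v prime_cycle \<Rightarrow> 'v \<Rightarrow> 'v" where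
  "successor c v = (if v \<in> cycle_verts c then hd (word_succs (cycle_word c) v) else v)"

text \<open>
  Access to an abstract simple cycle: listing its vertices in cyclic order makes it the graph of the
  cyclic permutation of that list.
\<close>

lemma prime_cycle_as_permutation:
  obtains vs where "vs \<noteq> []" "distinct vs" "set vs = cycle_verts c"
    "successor c = cycle_of_list vs" "simple_cycle (map (\<lambda>v. (v, cycle_of_list vs v)) vs)"
    "c = abs_prime_cycle (map (\<lambda>v. (v, cycle_of_list vs v)) vs)"
proof -
  obtain p where p: "c = abs_prime_cycle p" "simple_cycle p" by (rule prime_cycle_cases)
  define vs where "vs = map fst p"
  have vs: "vs \<noteq> []" "distinct vs" "map snd p = rotate1 vs"
    using p(2) by (auto simp: simple_cycle_iff vs_def)
  have verts: "set vs = cycle_verts c"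
    using p by (simp add: cycle_verts_abs vs_def)
  have "map snd p = map (cycle_of_list vs) (map fst p)"
    using cyclic_rotation[OF vs(2), of 1] vs(3) by (simp add: vs_def)
  then have snd: "snd e = cycle_of_list vs (fst e)" if "e \<in> set p" for e
    using that by simp
  have "successor c v = cycle_of_list vs v" for v
  proof (cases "v \<in> set vs")
    case True
    then obtain e where e: "e \<in> set p" "v = fst e" by (auto simp: vs_def)
    then have "(v, cycle_of_list vs v) \<in> set p" using snd by (metis prod.collapse)
    then have "succs p v = [cycle_of_list vs v]"
      using vs(2) by (intro succs_distinct) (simp_all add: vs_def)
    then show ?thesis
      using True verts p by (simp add: successor_def word_succs_cycle)
  next
    case False
    then show ?thesis using verts by (simp add: successor_def id_outside_supp)
  qed
  then have succ: "successor c = cycle_of_list vs" by blast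
  have "map (\<lambda>v. (v, cycle_of_list vs v)) vs = map (\<lambda>e. (fst e, cycle_of_list vs (fst e))) p"
    by (simp add: vs_def)
  also have "\<dots> = p" using snd by (intro map_idI) (metis prod.collapse)
  finally have graph: "map (\<lambda>v. (v, cycle_of_list vs v)) vs = p" .
  show ?thesis by (rule that[OF vs(1,2) verts succ]) (unfold graph, rule p(2), rule p(1))
qed

text \<open>
  The edges of a simple cycle have distinct initial vertices and hence all commute, so that the
  vertices may be listed in any order.
\<close>

lemma cycle_word_successor:
  assumes "distinct vs" "set vs = cycle_verts c"
  shows "cycle_word c = abs_edge_word (map (\<lambda>v. (v, successor c v)) vs)"
proof -
  obtain us where us: "us \<noteq> []" "distinct us" "set us = cycle_verts c"
    "successor c = cycle_of_list us" "simple_cycle (map (\<lambda>v. (v, cycle_of_list us v)) us)"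
    "c = abs_prime_cycle (map (\<lambda>v. (v, cycle_of_list us v)) us)"
    by (rule prime_cycle_as_permutation)
  have "mset us = mset vs" using us assms by (simp add: set_eq_iff_mset_eq_distinct[symmetric])
  then have "mset (map (\<lambda>v. (v, successor c v)) us) = mset (map (\<lambda>v. (v, successor c v)) vs)"
    by (metis mset_map)
  then have "trace_cong (\<lambda>e f. fst e \<noteq> fst f) (map (\<lambda>v. (v, successor c v)) us)
      (map (\<lambda>v. (v, successor c v)) vs)"
    using us(2) by (intro trace_cong_permute) (auto simp: distinct_map inj_on_def)
  moreover have "cycle_word c = abs_edge_word (map (\<lambda>v. (v, successor c v)) us)"
    unfolding us(4) by (subst us(6)) (rule cycle_word.abs_eq[OF same_cycle_refl[OF us(5)]])
  ultimately show ?thesis by (simp add: edge_word.abs_eq_iff)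
qed

lemma sign_cycle_of_list:
  assumes "vs \<noteq> []" "distinct vs"
  shows "sign (cycle_of_list vs) = - ((- 1) ^ length vs)"
  using assms
proof (induction vs rule: cycle_of_list.induct)
  case (1 i j cs)
  have "sign (cycle_of_list (i # j # cs)) = sign (transpose i j) * sign (cycle_of_list (j # cs))"
    by (simp only: cycle_of_list.simps sign_compose permutation_swap_id permutation_of_cycle)
  with 1 show ?case by (simp add: sign_swap_id del: cycle_of_list.simps)
qed simp_all

lemma successor_permutes: "successor c permutes cycle_verts c"
  and finite_cycle_verts: "finite (cycle_verts c)"
  and sign_successor: "sign (successor c) = - ((- 1) ^ card (cycle_verts c))"
proof -
  obtain vs where vs: "vs \<noteq> []" "distinct vs" "set vs = cycle_verts c"
    "successor c = cycle_of_list vs" "simple_cycle (map (\<lambda>v. (v, cycle_of_list vs v)) vs)"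
    "c = abs_prime_cycle (map (\<lambda>v. (v, cycle_of_list vs v)) vs)"
    by (rule prime_cycle_as_permutation)
  have card: "card (cycle_verts c) = length vs"
    using vs(2,3) by (metis distinct_card)
  show "successor c permutes cycle_verts c" "finite (cycle_verts c)"
    unfolding vs(3)[symmetric] vs(4) by (simp_all add: cycle_permutes)
  show "sign (successor c) = - ((- 1) ^ card (cycle_verts c))"
    unfolding card vs(4) using vs(1,2) by (rule sign_cycle_of_list)
qed

lemma successor_in: "v \<in> cycle_verts c \<Longrightarrow> successor c v \<in> cycle_verts c"
  by (simp add: permutes_in_image[OF successor_permutes])

lemma word_succs_cycle_word:
  "word_succs (cycle_word c) v = (if v \<in> cycle_verts c then [successor c v] else [])"
proof (cases "v \<in> cycle_verts c")
  case True
  obtain u where "word_succs (cycle_word c) v = [u]"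
    using cycle_succs_in[OF True] by (elim exE)
  with True show ?thesis by (simp add: successor_def)
qed (simp add: cycle_succs_notin)

text \<open>
  Membership in \<open>primes G\<close> becomes a condition on single arcs, which can be compared with the
  condition for a term of the determinant expansion not to vanish.
\<close>

lemma mem_primes_iff:
  assumes "pair_wf_digraph G"
  shows "c \<in> primes G \<longleftrightarrow> (\<forall>v\<in>cycle_verts c. (v, successor c v) \<in> parcs G)"
proof
  assume "c \<in> primes G"
  then obtain p where c: "c = abs_prime_cycle p" and "pre_digraph.cycle (with_proj G) p"
    by (auto simp: primes_def)
  then have p: "simple_cycle p" "set p \<subseteq> parcs G"
    by (auto simp: cycle_iff[OF assms] simple_cycle_iff)
  show "\<forall>v\<in>cycle_verts c. (v, successor c v) \<in> parcs G"
  proof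
    fix v assume "v \<in> cycle_verts c"
    then obtain u where u: "(v, u) \<in> set p" using p c by (auto simp: cycle_verts_abs)
    then have "word_succs (cycle_word c) v = [u]"
      using p c by (simp add: word_succs_cycle simple_cycle_iff succs_distinct)
    with u p(2) show "(v, successor c v) \<in> parcs G"
      using \<open>v \<in> cycle_verts c\<close> by (auto simp: word_succs_cycle_word)
  qed
next
  assume *: "\<forall>v\<in>cycle_verts c. (v, successor c v) \<in> parcs G"
  obtain vs where vs: "vs \<noteq> []" "distinct vs" "set vs = cycle_verts c"
    "successor c = cycle_of_list vs" "simple_cycle (map (\<lambda>v. (v, cycle_of_list vs v)) vs)"
    "c = abs_prime_cycle (map (\<lambda>v. (v, cycle_of_list vs v)) vs)"
    by (rule prime_cycle_as_permutation)
  have "pre_digraph.cycle (with_proj G) (map (\<lambda>v. (v, cycle_of_list vs v)) vs)"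
    using vs(5) * unfolding cycle_iff[OF assms] simple_cycle_iff by (auto simp: vs(3,4)[symmetric])
  then show "c \<in> primes G"
    unfolding primes_def by (intro CollectI exI conjI) (rule vs(6))
qed

section \<open>Families of disjoint cycles\<close>

definition disjoint_cycles :: "'v prime_cycle set \<Rightarrow> bool" where
  "disjoint_cycles P \<longleftrightarrow> finite P \<and> pairwise (\<lambda>c d. cycle_verts c \<inter> cycle_verts d = {}) P"

abbreviation family_verts :: "'v prime_cycle set \<Rightarrow> 'v set" where
  "family_verts P \<equiv> \<Union> (cycle_verts ` P)"

text \<open>
  The cycle through \<open>v\<close> is unique when the family is disjoint, see \<open>family_perm_in\<close>.
\<close>

definition family_perm :: "'v prime_cycle set \<Rightarrow> 'v \<Rightarrow> 'v" where
  "family_perm P v =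
    (if v \<in> family_verts P then successor (THE c. c \<in> P \<and> v \<in> cycle_verts c) v else v)"

lemma disjoint_cycles_subset: "disjoint_cycles P \<Longrightarrow> Q \<subseteq> P \<Longrightarrow> disjoint_cycles Q"
  unfolding disjoint_cycles_def by (blast intro: finite_subset pairwise_subset)

lemma disjoint_cyclesD:
  "disjoint_cycles P \<Longrightarrow> c \<in> P \<Longrightarrow> d \<in> P \<Longrightarrow> v \<in> cycle_verts c \<Longrightarrow> v \<in> cycle_verts d \<Longrightarrow> c = d"
  unfolding disjoint_cycles_def pairwise_def by blast

lemma disjoint_cycles_Un:
  assumes "disjoint_cycles P" "disjoint_cycles Q" "family_verts P \<inter> family_verts Q = {}"
  shows "disjoint_cycles (P \<union> Q)"
  unfolding disjoint_cycles_def
proof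
  show "finite (P \<union> Q)" using assms by (simp add: disjoint_cycles_def)
  show "pairwise (\<lambda>c d. cycle_verts c \<inter> cycle_verts d = {}) (P \<union> Q)"
    using assms unfolding disjoint_cycles_def pairwise_def by blast
qed

lemma disjoint_cycles_insertD:
  assumes "disjoint_cycles (insert c P)" "c \<notin> P"
  shows "disjoint_cycles P" "cycle_verts c \<inter> family_verts P = {}"
  using disjoint_cycles_subset[OF assms(1)] disjoint_cyclesD[OF assms(1)] assms(2) by blast+

lemma family_perm_in:
  assumes "disjoint_cycles P" "c \<in> P" "v \<in> cycle_verts c"
  shows "family_perm P v = successor c v"
proof -
  have "(THE c. c \<in> P \<and> v \<in> cycle_verts c) = c"
    using assms by (auto dest: disjoint_cyclesD)
  with assms show ?thesis by (auto simp: family_perm_def)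
qed

lemma family_perm_notin: "v \<notin> family_verts P \<Longrightarrow> family_perm P v = v"
  by (simp add: family_perm_def)

text \<open>
  The permutation of a family is the product of its cyclic permutations, which is what determines
  its sign.
\<close>

lemma family_perm_insert:
  assumes "disjoint_cycles (insert c P)" "c \<notin> P"
  shows "family_perm (insert c P) = successor c \<circ> family_perm P"
proof
  fix v
  note P = disjoint_cycles_insertD[OF assms]
  have out: "successor c u = u" if "u \<notin> cycle_verts c" for u
    using that by (simp add: successor_def)
  consider "v \<in> cycle_verts c" | d where "d \<in> P" "v \<in> cycle_verts d" "v \<notin> cycle_verts c"
    | "v \<notin> family_verts (insert c P)" by blast
  then show "family_perm (insert c P) v = (successor c \<circ> family_perm P) v"
  proof cases
    case 1
    then have "v \<notin> family_verts P" using P(2) by blast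
    then show ?thesis using 1 family_perm_in[OF assms(1), of c v] by (simp add: family_perm_def)
  next
    case 2
    then have "successor d v \<notin> cycle_verts c" using P(2) successor_in[of v d] by blast
    then show ?thesis
      using 2 family_perm_in[OF assms(1), of d v] family_perm_in[OF P(1), of d v] by (simp add: out)
  next
    case 3
    then show ?thesis by (simp add: family_perm_notin out)
  qed
qed

text \<open>
  The factor \<open>(- 1) ^ card (family_verts P)\<close> comes from the entries of \<open>- W\<close>. Each cycle contributes
  \<open>- 1\<close> to the product of the two signs, whatever its length.
\<close>

lemma family_perm_sign:
  assumes "disjoint_cycles P"
  shows "family_perm P permutes family_verts P"
    and "(- 1) ^ card (family_verts P) * sign (family_perm P) = (- 1) ^ card P"
proof -
  have "finite P" using assms by (simp add: disjoint_cycles_def)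
  then have "family_perm P permutes family_verts P \<and>
    (- 1) ^ card (family_verts P) * sign (family_perm P) = (- 1) ^ card P"
    using assms
  proof (induction P rule: finite_induct)
    case empty
    have "family_perm {} = (\<lambda>v. v :: 'a)" by (simp add: family_perm_def fun_eq_iff)
    then show ?case by (simp add: permutes_id[unfolded id_def])
  next
    case (insert c P)
    note P = disjoint_cycles_insertD[OF insert.prems insert.hyps(2)]
    note perm = family_perm_insert[OF insert.prems insert.hyps(2)]
    have IH: "family_perm P permutes family_verts P"
      "(- 1) ^ card (family_verts P) * sign (family_perm P) = (- 1) ^ card P"
      using insert.IH[OF P(1)] by blast+
    have fin: "finite (family_verts P)" using insert.hyps(1) finite_cycle_verts by blast
    have "family_perm (insert c P) permutes family_verts (insert c P)"
      unfolding perm using IH(1) successor_permutes[of c]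
      by (intro permutes_compose) (auto elim: permutes_subset)
    moreover have "card (family_verts (insert c P)) = card (cycle_verts c) + card (family_verts P)"
      using P(2) fin finite_cycle_verts[of c] by (simp add: card_Un_disjoint)
    moreover have "sign (family_perm (insert c P)) = - ((- 1) ^ card (cycle_verts c)) * sign (family_perm P)"
      unfolding perm using IH(1) fin successor_permutes[of c] finite_cycle_verts[of c]
      by (subst sign_compose) (auto simp: sign_successor intro: permutes_imp_permutation)
    moreover have "(- 1) ^ n * ((- 1) ^ n * x) = x" for n and x :: int
      by (simp add: power_mult_distrib[symmetric] mult.assoc[symmetric])
    ultimately show ?case
      using IH(2) insert.hyps by (simp add: power_add mult_ac)
  qed
  then show "family_perm P permutes family_verts P"
    and "(- 1) ^ card (family_verts P) * sign (family_perm P) = (- 1) ^ card P" by blast+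
qed

text \<open>
  Two families with the same vertices and the same permutation are equal because two simple cycles
  that meet and have the same successors coincide. The permutation alone would not suffice: it does
  not distinguish a loop from an uncovered vertex.
\<close>

lemma disjoint_cycles_eqI:
  assumes P: "disjoint_cycles P" and Q: "disjoint_cycles Q"
    and verts: "family_verts P = family_verts Q" and perm: "family_perm P = family_perm Q"
  shows "P = Q"
proof -
  have sub: "A \<subseteq> B" if A: "disjoint_cycles A" and B: "disjoint_cycles B"
    and verts: "family_verts A = family_verts B" and perm: "family_perm A = family_perm B"
    for A B :: "'a prime_cycle set"
  proof
    fix c assume c: "c \<in> A"
    obtain v where v: "v \<in> cycle_verts c" using cycle_verts_nonempty[of c] by auto
    then obtain d where d: "d \<in> B" "v \<in> cycle_verts d" using c verts by blast
    have "c = d"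
    proof (rule prime_cycle_agree)
      show "cycle_verts c \<inter> cycle_verts d \<noteq> {}" using v d by blast
    next
      fix u assume u: "u \<in> cycle_verts c" "u \<in> cycle_verts d"
      then have "successor c u = successor d u"
        using family_perm_in[OF A c u(1)] family_perm_in[OF B d(1) u(2)] perm by simp
      with u show "word_succs (cycle_word c) u = word_succs (cycle_word d) u"
        by (simp add: word_succs_cycle_word)
    qed
    with d show "c \<in> B" by simp
  qed
  show ?thesis
    by (rule subset_antisym[OF sub[OF P Q verts perm] sub[OF Q P verts[symmetric] perm[symmetric]]])
qed

section \<open>The hike of a family\<close>

definition family_hike :: "'v prime_cycle set \<Rightarrow> 'v hike" where
  "family_hike P = abs_hike (SOME cs. distinct cs \<and> set cs = P)"

text \<open>
  Disjoint cycles commute, so the order in which a family is enumerated is irrelevant.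
\<close>

lemma family_hike_eq:
  assumes P: "disjoint_cycles P" and cs: "distinct cs" "set cs = P"
  shows "family_hike P = abs_hike cs"
proof -
  define ds where "ds = (SOME cs. distinct cs \<and> set cs = P)"
  have ds: "distinct ds \<and> set ds = P"
    unfolding ds_def by (rule someI[of "\<lambda>cs. distinct cs \<and> set cs = P" cs]) (use cs in simp)
  have "trace_cong (\<lambda>c d. cycle_verts c \<inter> cycle_verts d = {}) ds cs"
  proof (rule trace_cong_permute)
    show "mset ds = mset cs" using ds cs by (simp add: set_eq_iff_mset_eq_distinct[symmetric])
  qed (use ds P in \<open>auto simp: disjoint_cycles_def pairwise_def\<close>)
  then show ?thesis by (simp add: family_hike_def ds_def hike.abs_eq_iff)
qed

lemma family_hike_empty: "family_hike {} = 1"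
  using family_hike_eq[of "{}" "[]"] by (simp add: disjoint_cycles_def one_hike_def)

lemma family_hike_singleton: "family_hike {c} = prime_hike c"
  using family_hike_eq[of "{c}" "[c]"] by (simp add: disjoint_cycles_def prime_hike.abs_eq)

lemma family_hike_Un:
  assumes PQ: "disjoint_cycles (P \<union> Q)" and "P \<inter> Q = {}"
  shows "family_hike (P \<union> Q) = family_hike P * family_hike Q"
proof -
  have P: "disjoint_cycles P" and Q: "disjoint_cycles Q"
    using disjoint_cycles_subset[OF PQ] by blast+
  obtain cs where cs: "distinct cs" "set cs = P"
    using P finite_distinct_list[of P] by (auto simp: disjoint_cycles_def)
  obtain ds where ds: "distinct ds" "set ds = Q"
    using Q finite_distinct_list[of Q] by (auto simp: disjoint_cycles_def)
  have "family_hike (P \<union> Q) = abs_hike (cs @ ds)"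
    using PQ cs ds assms(2) by (intro family_hike_eq) auto
  then show ?thesis
    using family_hike_eq[OF P cs] family_hike_eq[OF Q ds] by (simp add: times_hike.abs_eq)
qed

lemma hike_length_family_hike:
  assumes "disjoint_cycles P"
  shows "hike_length (family_hike P) = (\<Sum>c\<in>P. cycle_length c)"
proof -
  obtain cs where cs: "distinct cs" "set cs = P"
    using assms finite_distinct_list[of P] by (auto simp: disjoint_cycles_def)
  then show ?thesis
    using family_hike_eq[OF assms cs] by (auto simp: hike_length.abs_eq sum_list_distinct_conv_sum_set)
qed

text \<open>
  As a word in edges, the hike of a family is the term that its permutation contributes to the
  determinant expansion, whatever the order \<open>xs\<close> of the rows: both words contain the same edges, and
  these have distinct initial vertices.
\<close>

lemma hike_word_family_hike:
  assumes "disjoint_cycles P" "distinct xs" "set xs = family_verts P"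
  shows "hike_word (family_hike P) = prod_list (map (\<lambda>i. edge i (family_perm P i)) xs)"
proof -
  have "finite P" using assms by (simp add: disjoint_cycles_def)
  then show ?thesis using assms
  proof (induction P arbitrary: xs rule: finite_induct)
    case empty
    then show ?case by (simp add: family_hike_empty)
  next
    case (insert c P)
    note P = disjoint_cycles_insertD[OF insert.prems(1) insert.hyps(2)]
    let ?\<sigma> = "family_perm (insert c P)"
    obtain vs where vs: "set vs = cycle_verts c" "distinct vs"
      using finite_distinct_list[OF finite_cycle_verts[of c]] by (elim exE conjE)
    have fin: "finite (family_verts P)" using insert.hyps(1) finite_cycle_verts by blast
    obtain ys where ys: "set ys = family_verts P" "distinct ys"
      using finite_distinct_list[OF fin] by (elim exE conjE)
    have "family_hike (insert c P) = prime_hike c * family_hike P"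
      using family_hike_Un[of "{c}" P] insert.hyps insert.prems(1)
      by (simp add: family_hike_singleton)
    then have "hike_word (family_hike (insert c P)) =
        cycle_word c * prod_list (map (\<lambda>i. edge i (family_perm P i)) ys)"
      using insert.IH[OF P(1) ys(2,1)] by simp
    also have "map (\<lambda>i. edge i (family_perm P i)) ys = map (\<lambda>i. edge i (?\<sigma> i)) ys"
    proof (rule map_cong[OF refl])
      fix i assume "i \<in> set ys"
      then obtain d where d: "d \<in> P" "i \<in> cycle_verts d" using ys by blast
      then show "edge i (family_perm P i) = edge i (?\<sigma> i)"
        using family_perm_in[OF P(1) d] family_perm_in[OF insert.prems(1), of d i] by simp
    qed
    also have "cycle_word c = abs_edge_word (map (\<lambda>i. (i, successor c i)) vs)"
      using vs(2,1) by (rule cycle_word_successor)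
    also have "map (\<lambda>i. (i, successor c i)) vs = map (\<lambda>i. (i, ?\<sigma> i)) vs"
      using vs family_perm_in[OF insert.prems(1), of c] by simp
    also have "abs_edge_word (map (\<lambda>i. (i, ?\<sigma> i)) vs) * prod_list (map (\<lambda>i. edge i (?\<sigma> i)) ys) =
        abs_edge_word (map (\<lambda>i. (i, ?\<sigma> i)) (vs @ ys))"
      by (simp add: prod_list_edges times_edge_word.abs_eq)
    also have "\<dots> = abs_edge_word (map (\<lambda>i. (i, ?\<sigma> i)) xs)"
    proof -
      have "distinct (vs @ ys)" using vs ys P(2) by auto
      moreover from this have "mset (vs @ ys) = mset xs"
        using set_eq_iff_mset_eq_distinct[OF _ insert.prems(2), of "vs @ ys"] vs ys insert.prems(3)
        by simp
      ultimately have "trace_cong (\<lambda>e f. fst e \<noteq> fst f) (map (\<lambda>i. (i, ?\<sigma> i)) (vs @ ys))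
          (map (\<lambda>i. (i, ?\<sigma> i)) xs)"
        by (intro trace_cong_permute) (metis mset_map, auto simp: distinct_map inj_on_def)
      then show ?thesis by (simp only: edge_word.abs_eq_iff)
    qed
    finally show ?case by (simp add: prod_list_edges)
  qed
qed

section \<open>Permutations along the arcs of a digraph\<close>

definition cycle_families :: "'v pair_pre_digraph \<Rightarrow> 'v prime_cycle set set" where
  "cycle_families G = {P. P \<subseteq> primes G \<and> disjoint_cycles P}"

lemma word_succs_edges:
  "distinct xs \<Longrightarrow> word_succs (prod_list (map (\<lambda>i. edge i (f i)) xs)) v = (if v \<in> set xs then [f v] else [])"
  by (induction xs) (auto simp: edge.abs_eq succs_def)

text \<open>
  A hike that leaves every vertex at most once is the hike of a disjoint family, since two primes
  through a common vertex would leave it twice. The family is recovered from the successor words,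
  which is how a permutation will be split into cycles below.
\<close>

lemma family_of_word_succs:
  assumes "\<And>v. length (word_succs (hike_word (abs_hike cs)) v) \<le> 1"
  shows "disjoint_cycles (set cs)"
    and "word_succs (hike_word (abs_hike cs)) v =
      (if v \<in> family_verts (set cs) then [family_perm (set cs) v] else [])"
proof -
  let ?S = "\<lambda>cs. word_succs (prod_list (map cycle_word cs))"
  have word: "hike_word (abs_hike cs) = prod_list (map cycle_word cs)"
    by (simp add: hike_word.abs_eq)
  have occ: "successor c v \<in> set (?S cs v)" if "c \<in> set cs" "v \<in> cycle_verts c" for c v and cs :: "'a prime_cycle list"
    using that by (induction cs) (auto simp: word_succs_cycle_word)
  have "\<forall>v. length (?S cs v) \<le> 1" using assms by (simp add: word)
  then show disj: "disjoint_cycles (set cs)"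
  proof (induction cs)
    case Nil
    show ?case by (simp add: disjoint_cycles_def)
  next
    case (Cons c cs)
    have "length (?S cs v) \<le> 1" for v using Cons.prems[rule_format, of v] by simp
    moreover have "v \<notin> cycle_verts d" if "v \<in> cycle_verts c" "d \<in> set cs" for v d
    proof
      assume "v \<in> cycle_verts d"
      with that have "?S cs v \<noteq> []" using occ[of d cs v] by auto
      moreover have "length (?S (c # cs) v) \<le> 1" using Cons.prems by blast
      ultimately show False using that(1) by (simp add: word_succs_cycle_word)
    qed
    ultimately show ?case
      using disjoint_cycles_Un[of "{c}" "set cs"] Cons.IH by (auto simp: disjoint_cycles_def)
  qed
  show "word_succs (hike_word (abs_hike cs)) v =
      (if v \<in> family_verts (set cs) then [family_perm (set cs) v] else [])"
  proof (cases "v \<in> family_verts (set cs)")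
    case True
    then obtain c where c: "c \<in> set cs" "v \<in> cycle_verts c" by blast
    have "family_perm (set cs) v \<in> set (?S cs v)"
      using occ[OF c] family_perm_in[OF disj c] by simp
    with assms[of v] True show ?thesis
      by (cases "?S cs v") (auto simp: word)
  next
    case False
    then have "?S cs v = []" by (induction cs) (auto simp: word_succs_cycle_word)
    with False show ?thesis by (simp add: word)
  qed
qed

text \<open>
  Surjectivity uses that the product of the edges \<open>(i, \<sigma> i)\<close> is the word of some hike; this hike
  leaves every vertex of \<open>S\<close> once and no other vertex, so it is a disjoint family with permutation \<open>\<sigma>\<close>.
\<close>

lemma bij_betw_family_perm:
  assumes G: "pair_wf_digraph G" and S: "finite S"
  shows "bij_betw family_perm {P \<in> cycle_families G. family_verts P = S}
    {\<sigma>. \<sigma> permutes S \<and> (\<forall>i\<in>S. (i, \<sigma> i) \<in> parcs G)}"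
proof (rule bij_betw_imageI)
  show "inj_on family_perm {P \<in> cycle_families G. family_verts P = S}"
    by (rule inj_onI, rule disjoint_cycles_eqI) (auto simp: cycle_families_def)
  show "family_perm ` {P \<in> cycle_families G. family_verts P = S} =
    {\<sigma>. \<sigma> permutes S \<and> (\<forall>i\<in>S. (i, \<sigma> i) \<in> parcs G)}"
  proof (intro equalityI subsetI)
    fix \<sigma> assume "\<sigma> \<in> family_perm ` {P \<in> cycle_families G. family_verts P = S}"
    then obtain P where P: "P \<subseteq> primes G" "disjoint_cycles P" "family_verts P = S"
      and \<sigma>: "\<sigma> = family_perm P" by (auto simp: cycle_families_def)
    have "(i, \<sigma> i) \<in> parcs G" if "i \<in> S" for i
    proof -
      from that P(3) obtain c where c: "c \<in> P" "i \<in> cycle_verts c" by blast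
      then show ?thesis
        using P(1) family_perm_in[OF P(2) c] mem_primes_iff[OF G] by (auto simp: \<sigma>)
    qed
    then show "\<sigma> \<in> {\<sigma>. \<sigma> permutes S \<and> (\<forall>i\<in>S. (i, \<sigma> i) \<in> parcs G)}"
      using family_perm_sign(1)[OF P(2)] P(3) \<sigma> by auto
  next
    fix \<sigma> assume "\<sigma> \<in> {\<sigma>. \<sigma> permutes S \<and> (\<forall>i\<in>S. (i, \<sigma> i) \<in> parcs G)}"
    then have \<sigma>: "\<sigma> permutes S" and arcs: "\<And>i. i \<in> S \<Longrightarrow> (i, \<sigma> i) \<in> parcs G" by blast+
    obtain xs where xs: "distinct xs" "set xs = S" using finite_distinct_list[OF S] by blast
    obtain h where h: "prod_list (map (\<lambda>i. edge i (\<sigma> i)) xs) = hike_word h"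
      using permutation_word_hike[OF S \<sigma> xs] by blast
    obtain cs where cs: "h = abs_hike cs" by (rule hike_cases)
    have succs: "word_succs (hike_word (abs_hike cs)) v = (if v \<in> S then [\<sigma> v] else [])" for v
      using word_succs_edges[OF xs(1), of \<sigma> v] xs(2) by (simp add: h cs)
    then have "length (word_succs (hike_word (abs_hike cs)) v) \<le> 1" for v by simp
    note fam = family_of_word_succs[OF this]
    have both: "(if v \<in> S then [\<sigma> v] else []) =
        (if v \<in> family_verts (set cs) then [family_perm (set cs) v] else [])" for v
      using fam(2)[of v] succs[of v] by simp
    have verts: "family_verts (set cs) = S"
      using both by (metis (no_types, lifting) list.distinct(1) subsetI subset_antisym)
    have "family_perm (set cs) v = \<sigma> v" for v
    proof (cases "v \<in> S")
      case True
      then show ?thesis using both[of v] verts by simp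
    next
      case False
      then show ?thesis using verts \<sigma> by (simp add: family_perm_def permutes_not_in)
    qed
    then have perm: "family_perm (set cs) = \<sigma>" by blast
    have "set cs \<subseteq> primes G"
    proof
      fix c assume c: "c \<in> set cs"
      have "(v, successor c v) \<in> parcs G" if "v \<in> cycle_verts c" for v
        using arcs[of v] family_perm_in[OF fam(1) c that] c that verts perm by auto
      then show "c \<in> primes G" by (simp add: mem_primes_iff[OF G])
    qed
    with fam(1) verts perm show "\<sigma> \<in> family_perm ` {P \<in> cycle_families G. family_verts P = S}"
      by (intro image_eqI[of _ _ "set cs"]) (auto simp: cycle_families_def)
  qed
qed


section \<open>Series over hikes\<close>

lemma single_mult: "single a * single b = single (a * b :: 'm::finite_factor_monoid)"
proof (rule series_eqI)
  fix h
  have "coeff (single a * single b) h =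
      (\<Sum>p\<in>{(x, y). x * y = h}. if p = (a, b) then 1 else 0)"
    unfolding times_series.rep_eq single.rep_eq by (rule sum.cong) (auto split: if_splits)
  also have "\<dots> = coeff (single (a * b)) h"
    by (auto simp: sum.delta[OF finite_factors] single.rep_eq)
  finally show "coeff (single a * single b) h = coeff (single (a * b)) h" .
qed

lemma coeff_of_int_mult [simp]:
  fixes F :: "'m::finite_factor_monoid series"
  shows "coeff (of_int k * F) h = of_int k * coeff F h"
proof -
  have nat: "coeff (of_nat n * F) h = of_nat n * coeff F h" for n
    by (induction n) (simp_all add: distrib_right)
  show ?thesis
    by (cases k rule: int_cases2) (simp_all add: nat)
qed

text \<open>
  Real scalars enter only as images of integers (signs and lengths), which are central in any ring.
\<close>

lemma of_int_mult_of_int_mult: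
  fixes X Y :: "'r::ring_1"
  shows "(of_int k * X) * (of_int l * Y) = of_int (k * l) * (X * Y)"
  by (metis mult.assoc mult_of_int_commute of_int_mult)

lemma coeff_hike_series [simp]: "coeff (hike_series F) h = coeff F (hike_word h)"
  by (simp add: hike_series_def Series_inverse)

lemma hike_series_sum: "hike_series (\<Sum>a\<in>A. F a) = (\<Sum>a\<in>A. hike_series (F a))"
  by (rule series_eqI) simp

lemma hike_series_of_int: "hike_series (of_int k * F) = of_int k * hike_series F"
  by (rule series_eqI) simp

lemma hike_series_single: "hike_series (single (hike_word h)) = single h"
  by (rule series_eqI) (simp add: single.rep_eq inj_eq[OF inj_hike_word])

lemma coeff_derivation [simp]: "coeff (derivation F) h = real (hike_length h) * coeff F h"
  by (simp add: derivation_def Series_inverse)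

lemma derivation_sum: "derivation (\<Sum>a\<in>A. F a) = (\<Sum>a\<in>A. derivation (F a))"
  by (rule series_eqI) (simp add: sum_distrib_left)

lemma derivation_single: "derivation (single h) = of_int (int (hike_length h)) * single h"
  by (rule series_eqI) (simp add: single.rep_eq del: of_int_of_nat_eq)

section \<open>Determinants and permanents as sums over families\<close>

lemma adj_matrix_induced:
  assumes "i \<in> U" "j \<in> U"
  shows "adj_matrix (with_proj G \<restriction> U) i j = (if (i, j) \<in> parcs G then single (edge i j) else 0)"
proof -
  have "(i \<rightarrow>\<^bsub>with_proj G \<restriction> U\<^esub> j) \<longleftrightarrow> (i, j) \<in> parcs G"
    using assms by (auto simp: arcs_ends_def arc_to_ends_def)
  then show ?thesis by (simp add: adj_matrix_def)
qed

lemma prod_list_adj_matrix: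
  assumes "\<And>i. i \<in> set xs \<Longrightarrow> i \<in> U \<and> f i \<in> U"
  shows "prod_list (map (\<lambda>i. adj_matrix (with_proj G \<restriction> U) i (f i)) xs) =
    (if \<forall>i\<in>set xs. (i, f i) \<in> parcs G then single (prod_list (map (\<lambda>i. edge i (f i)) xs)) else 0)"
  using assms
  by (induction xs) (auto simp: one_series_def adj_matrix_induced single_mult)

text \<open>
  The common part of the determinant and the permanent: only the permutations along arcs give a
  nonzero product of matrix entries, and these are the disjoint families. The weight \<open>g\<close> is a signed
  \<open>sign\<close> for the determinant and constantly \<open>1\<close> for the permanent. The vertex sets \<open>S\<close> and \<open>U\<close>
  differ for the permanent, which is expanded into permanents of principal submatrices.
\<close>

lemma hike_series_permutation_sum:
  fixes G :: "'v::linorder pair_pre_digraph"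
  assumes G: "pair_wf_digraph G" and S: "finite S" "S \<subseteq> U"
  shows "hike_series (\<Sum>\<sigma> | \<sigma> permutes S. of_int (g \<sigma>) *
      prod_list (map (\<lambda>i. adj_matrix (with_proj G \<restriction> U) i (\<sigma> i)) (sorted_list_of_set S))) =
    (\<Sum>P | P \<in> cycle_families G \<and> family_verts P = S.
      of_int (g (family_perm P)) * single (family_hike P))"
proof -
  let ?t = "\<lambda>\<sigma>. prod_list (map (\<lambda>i. adj_matrix (with_proj G \<restriction> U) i (\<sigma> i)) (sorted_list_of_set S))"
  let ?w = "\<lambda>\<sigma>. prod_list (map (\<lambda>i. edge i (\<sigma> i)) (sorted_list_of_set S))"
  let ?A = "{\<sigma>. \<sigma> permutes S \<and> (\<forall>i\<in>S. (i, \<sigma> i) \<in> parcs G)}"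
  let ?F = "{P \<in> cycle_families G. family_verts P = S}"
  have t: "?t \<sigma> = (if \<forall>i\<in>S. (i, \<sigma> i) \<in> parcs G then single (?w \<sigma>) else 0)"
    if "\<sigma> permutes S" for \<sigma>
  proof (subst prod_list_adj_matrix)
    fix i assume "i \<in> set (sorted_list_of_set S)"
    then show "i \<in> U \<and> \<sigma> i \<in> U" using S permutes_in_image[OF that, of i] by auto
  qed (use S in simp)
  have "(\<Sum>\<sigma> | \<sigma> permutes S. of_int (g \<sigma>) * ?t \<sigma>) = (\<Sum>\<sigma>\<in>?A. of_int (g \<sigma>) * single (?w \<sigma>))"
    by (rule sum.mono_neutral_cong_right) (auto simp: t finite_permutations S)
  also have "\<dots> = (\<Sum>P\<in>?F. of_int (g (family_perm P)) * single (?w (family_perm P)))"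
    by (rule sum.reindex_bij_betw[OF bij_betw_family_perm[OF G S(1)], symmetric])
  also have "\<dots> = (\<Sum>P\<in>?F. of_int (g (family_perm P)) * single (hike_word (family_hike P)))"
  proof (rule sum.cong[OF refl])
    fix P assume "P \<in> ?F"
    then have P: "disjoint_cycles P" "family_verts P = S" by (auto simp: cycle_families_def)
    then have "set (sorted_list_of_set S) = family_verts P" using S(1) by simp
    from hike_word_family_hike[OF P(1) _ this]
    have "hike_word (family_hike P) = ?w (family_perm P)" by simp
    then show "of_int (g (family_perm P)) * single (?w (family_perm P)) =
        of_int (g (family_perm P)) * single (hike_word (family_hike P))" by simp
  qed
  finally have eq: "(\<Sum>\<sigma> | \<sigma> permutes S. of_int (g \<sigma>) * ?t \<sigma>) =
    (\<Sum>P\<in>?F. of_int (g (family_perm P)) * single (hike_word (family_hike P)))" .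
  show ?thesis
    unfolding eq by (simp add: hike_series_sum hike_series_of_int hike_series_single)
qed

lemma prod_list_uminus:
  "prod_list (map (\<lambda>i. - F i) xs) = of_int ((- 1) ^ length xs) * (prod_list (map F xs) :: 'r::ring_1)"
proof (induction xs)
  case (Cons x xs)
  have "F x * of_int ((- 1) ^ length xs) = of_int ((- 1) ^ length xs) * F x"
    by (rule mult_of_int_commute[symmetric])
  with Cons show ?case by (simp add: mult.assoc[symmetric])
qed simp

lemma hike_series_ncdet:
  fixes G :: "'v::linorder pair_pre_digraph"
  assumes G: "pair_wf_digraph G" and U: "finite U"
  shows "hike_series (ncdet U (\<lambda>i j. - adj_matrix (with_proj G \<restriction> U) i j)) =
    (\<Sum>P | P \<in> cycle_families G \<and> family_verts P = U. of_int ((- 1) ^ card P) * single (family_hike P))"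
proof -
  let ?W = "adj_matrix (with_proj G \<restriction> U)"
  have eq: "ncdet U (\<lambda>i j. - ?W i j) =
    (\<Sum>\<sigma> | \<sigma> permutes U. of_int ((- 1) ^ card U * sign \<sigma>) *
      prod_list (map (\<lambda>i. ?W i (\<sigma> i)) (sorted_list_of_set U)))"
    unfolding ncdet_def prod_list_uminus
    by (simp only: mult.assoc[symmetric] of_int_mult[symmetric] length_sorted_list_of_set mult.commute)
  have "hike_series (ncdet U (\<lambda>i j. - ?W i j)) =
      (\<Sum>P | P \<in> cycle_families G \<and> family_verts P = U.
        of_int ((- 1) ^ card U * sign (family_perm P)) * single (family_hike P))"
    unfolding eq by (rule hike_series_permutation_sum[OF G U order_refl])
  also have "\<dots> = (\<Sum>P | P \<in> cycle_families G \<and> family_verts P = U.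
      of_int ((- 1) ^ card P) * single (family_hike P))"
  proof (rule sum.cong[OF refl])
    fix P assume "P \<in> {P \<in> cycle_families G. family_verts P = U}"
    then have "disjoint_cycles P" "family_verts P = U" by (auto simp: cycle_families_def)
    from family_perm_sign(2)[OF this(1)] this(2)
    have "(- 1) ^ card U * sign (family_perm P) = (- 1) ^ card P" by simp
    then show "of_int ((- 1) ^ card U * sign (family_perm P)) * single (family_hike P) =
        of_int ((- 1) ^ card P) * single (family_hike P)" by (simp only:)
  qed
  finally show ?thesis .
qed

text \<open>
  The order of the factors is kept, so that the expansion holds in every ring.
\<close>

lemma prod_list_add:
  fixes F H :: "'i \<Rightarrow> 'r::ring_1"
  assumes "distinct xs"
  shows "prod_list (map (\<lambda>i. F i + H i) xs) =
    (\<Sum>T\<in>Pow (set xs). prod_list (map (\<lambda>i. if i \<in> T then H i else F i) xs))"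
  using assms
proof (induction xs)
  case (Cons x xs)
  let ?p = "\<lambda>T. prod_list (map (\<lambda>i. if i \<in> T then H i else F i) xs)"
  have x: "x \<notin> set xs" using Cons.prems by simp
  have ins: "?p (insert x T) = ?p T" for T
    using x by (intro arg_cong[of _ _ prod_list] map_cong) auto
  have "inj_on (insert x) (Pow (set xs))"
    using x by (auto simp: inj_on_def)
  moreover have "Pow (set xs) \<inter> insert x ` Pow (set xs) = {}" using x by auto
  ultimately have split: "(\<Sum>T\<in>Pow (set (x # xs)). f T) =
      (\<Sum>T\<in>Pow (set xs). f T) + (\<Sum>T\<in>Pow (set xs). f (insert x T))" for f :: "'i set \<Rightarrow> 'r"
    by (simp add: Pow_insert sum.union_disjoint sum.reindex)
  have "prod_list (map (\<lambda>i. F i + H i) (x # xs)) =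
      (\<Sum>T\<in>Pow (set xs). F x * ?p T) + (\<Sum>T\<in>Pow (set xs). H x * ?p T)"
    using Cons by (simp add: distrib_right sum_distrib_left sum.distrib)
  also have "(\<Sum>T\<in>Pow (set xs). F x * ?p T) =
      (\<Sum>T\<in>Pow (set xs). prod_list (map (\<lambda>i. if i \<in> T then H i else F i) (x # xs)))"
    using x by (intro sum.cong) auto
  also have "(\<Sum>T\<in>Pow (set xs). H x * ?p T) =
      (\<Sum>T\<in>Pow (set xs). prod_list (map (\<lambda>i. if i \<in> insert x T then H i else F i) (x # xs)))"
    by (simp only: list.map prod_list.Cons ins insertI1 if_True)
  finally show ?case unfolding split .
qed simp

text \<open>
  Choosing the identity entry outside \<open>T\<close> gives a nonzero product only if \<open>\<sigma>\<close> fixes every index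
  outside \<open>T\<close>; such \<open>\<sigma>\<close> are exactly the permutations of \<open>T\<close>, and the factors outside \<open>T\<close> are \<open>1\<close>.
\<close>

lemma ncperm_id_add:
  fixes A :: "'i::linorder \<Rightarrow> 'i \<Rightarrow> 'r::ring_1"
  assumes U: "finite U"
  shows "ncperm U (\<lambda>i j. id_matrix i j + A i j) = (\<Sum>T\<in>Pow U. ncperm T A)"
proof -
  let ?xs = "sorted_list_of_set U"
  let ?q = "\<lambda>\<sigma> T. prod_list (map (\<lambda>i. if i \<in> T then A i (\<sigma> i) else id_matrix i (\<sigma> i)) ?xs)"
  have "ncperm U (\<lambda>i j. id_matrix i j + A i j) = (\<Sum>\<sigma> | \<sigma> permutes U. \<Sum>T\<in>Pow U. ?q \<sigma> T)"
    unfolding ncperm_def using U by (simp add: prod_list_add)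
  also have "\<dots> = (\<Sum>T\<in>Pow U. \<Sum>\<sigma> | \<sigma> permutes U. ?q \<sigma> T)" by (rule sum.swap)
  also have "\<dots> = (\<Sum>T\<in>Pow U. ncperm T A)"
  proof (rule sum.cong[OF refl])
    fix T assume "T \<in> Pow U"
    then have T: "T \<subseteq> U" by blast
    then have finT: "finite T" using U by (rule finite_subset)
    have zero: "?q \<sigma> T = 0" if \<sigma>: "\<sigma> permutes U" "\<not> \<sigma> permutes T" for \<sigma>
    proof -
      obtain i where "i \<in> U - T" "\<sigma> i \<noteq> i" using permutes_superset[OF \<sigma>(1), of T] \<sigma>(2) by blast
      then have "0 \<in> set (map (\<lambda>i. if i \<in> T then A i (\<sigma> i) else id_matrix i (\<sigma> i)) ?xs)"
        using U by (force simp: id_matrix_def)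
      moreover have "prod_list ys = 0" if "0 \<in> set ys" for ys :: "'r list"
        using that by (induction ys) auto
      ultimately show ?thesis by blast
    qed
    have filter: "sorted_list_of_set T = filter (\<lambda>i. i \<in> T) ?xs"
      using U T finT by (intro sorted_distinct_set_unique) (auto intro: sorted_wrt_filter)
    have one: "?q \<sigma> T = prod_list (map (\<lambda>i. A i (\<sigma> i)) (sorted_list_of_set T))"
      if "\<sigma> permutes T" for \<sigma>
    proof -
      have "prod_list (map (\<lambda>i. if i \<in> T then A i (\<sigma> i) else id_matrix i (\<sigma> i)) xs) =
          prod_list (map (\<lambda>i. A i (\<sigma> i)) (filter (\<lambda>i. i \<in> T) xs))" for xs
        using permutes_not_in[OF that] by (induction xs) (simp_all add: id_matrix_def)
      then show ?thesis by (simp add: filter)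
    qed
    show "(\<Sum>\<sigma> | \<sigma> permutes U. ?q \<sigma> T) = ncperm T A"
      unfolding ncperm_def
      by (rule sum.mono_neutral_cong_right)
        (use U T zero one in \<open>auto simp: finite_permutations intro: permutes_subset\<close>)
  qed
  finally show ?thesis .
qed

lemma finite_cycle_families:
  assumes "pair_fin_digraph G" shows "finite (cycle_families G)"
  by (rule finite_subset[of _ "Pow (primes G)"])
    (auto simp: cycle_families_def finite_primes[OF assms])

lemma hike_series_ncperm:
  fixes G :: "'v::linorder pair_pre_digraph"
  assumes G: "pair_fin_digraph G" and U: "finite U"
  shows "hike_series (ncperm U (\<lambda>i j. id_matrix i j + adj_matrix (with_proj G \<restriction> U) i j)) =
    (\<Sum>P | P \<in> cycle_families G \<and> family_verts P \<subseteq> U. single (family_hike P))"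
proof -
  interpret pair_fin_digraph G by fact
  have "hike_series (ncperm T (adj_matrix (with_proj G \<restriction> U))) =
      (\<Sum>P | P \<in> cycle_families G \<and> family_verts P = T. single (family_hike P))" if "T \<subseteq> U" for T
    using hike_series_permutation_sum[OF pair_wf_digraph_axioms finite_subset[OF that U] that, of "\<lambda>_. 1"]
    by (simp add: ncperm_def)
  then have "hike_series (ncperm U (\<lambda>i j. id_matrix i j + adj_matrix (with_proj G \<restriction> U) i j)) =
      (\<Sum>T\<in>Pow U. \<Sum>P | P \<in> cycle_families G \<and> family_verts P = T. single (family_hike P))"
    by (simp add: ncperm_id_add[OF U] hike_series_sum)
  also have "\<dots> = (\<Sum>T\<in>Pow U. \<Sum>P | P \<in> {P \<in> cycle_families G. family_verts P \<subseteq> U} \<and> family_verts P = T.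
      single (family_hike P))"
    by (intro sum.cong refl) auto
  also have "\<dots> = (\<Sum>P | P \<in> cycle_families G \<and> family_verts P \<subseteq> U. single (family_hike P))"
    by (rule sum.group) (use U finite_cycle_families[OF G] in auto)
  finally show ?thesis .
qed

section \<open>The cancellation\<close>

text \<open>
  Expansion of the product of \<open>card P\<close> factors \<open>- 1 + 1\<close>.
\<close>

lemma alternating_Pow_sum:
  assumes "finite P"
  shows "(\<Sum>A\<in>Pow P. (- 1) ^ card A) = (if P = {} then 1 else 0 :: int)"
proof -
  have "(\<Sum>A\<in>Pow P. (- 1) ^ card A) = (\<Sum>A\<in>Pow P. (\<Prod>x\<in>A. - 1) * (\<Prod>x\<in>P - A. 1 :: int))"
    by simp
  also have "\<dots> = (\<Prod>x\<in>P. (- 1) + (1 :: int))"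
    by (rule prod_add[OF assms, symmetric])
  also have "\<dots> = (if P = {} then 1 else 0)" using assms by (simp add: card_gt_0_iff)
  finally show ?thesis .
qed

text \<open>
  After exchanging the sums, the coefficient of \<open>f c\<close> is the alternating sum over the subsets of
  \<open>P - {c}\<close>. The right-hand side is \<open>f c\<close> if \<open>P\<close> is the singleton \<open>{c}\<close> and \<open>0\<close> otherwise.
\<close>

lemma alternating_weight_sum:
  fixes f :: "'c \<Rightarrow> int"
  assumes "finite P"
  shows "(\<Sum>A\<in>Pow P. (- 1) ^ card A * (\<Sum>c\<in>P - A. f c)) = (\<Sum>c | c \<in> P \<and> P = {c}. f c)"
proof -
  have "(\<Sum>A\<in>Pow P. (- 1) ^ card A * (\<Sum>c\<in>P - A. f c)) =
      (\<Sum>A\<in>Pow P. \<Sum>c\<in>P - A. (- 1) ^ card A * f c)"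
    by (simp add: sum_distrib_left)
  also have "\<dots> = (\<Sum>A\<in>Pow P. \<Sum>c | c \<in> P \<and> c \<notin> A. (- 1) ^ card A * f c)"
    by (intro sum.cong) auto
  also have "\<dots> = (\<Sum>c\<in>P. \<Sum>A | A \<in> Pow P \<and> c \<notin> A. (- 1) ^ card A * f c)"
    using assms by (intro sum.swap_restrict) auto
  also have "\<dots> = (\<Sum>c\<in>P. (\<Sum>A\<in>Pow (P - {c}). (- 1) ^ card A) * f c)"
    unfolding sum_distrib_right by (intro sum.cong) auto
  also have "\<dots> = (\<Sum>c\<in>P. if P = {c} then f c else 0)"
    using assms by (intro sum.cong) (auto simp: alternating_Pow_sum)
  also have "\<dots> = (\<Sum>c | c \<in> P \<and> P = {c}. f c)"
    using assms by (rule sum.inter_filter[symmetric])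
  finally show ?thesis .
qed

lemma cycle_families_subset: "P \<in> cycle_families G \<Longrightarrow> A \<subseteq> P \<Longrightarrow> A \<in> cycle_families G"
  by (auto simp: cycle_families_def intro: disjoint_cycles_subset)

lemma family_verts_disjoint:
  assumes "disjoint_cycles P" "A \<subseteq> P" "B \<subseteq> P" "A \<inter> B = {}"
  shows "family_verts A \<inter> family_verts B = {}"
proof -
  have False if "a \<in> A" "b \<in> B" "v \<in> cycle_verts a" "v \<in> cycle_verts b" for a b v
    using disjoint_cyclesD[OF assms(1), of a b v] that assms(2-4) by auto
  then show ?thesis by blast
qed

lemma families_disjoint: "family_verts A \<inter> family_verts B = {} \<Longrightarrow> A \<inter> B = {}"
proof (rule ccontr)
  assume disj: "family_verts A \<inter> family_verts B = {}" and "A \<inter> B \<noteq> {}"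
  then obtain c where c: "c \<in> A" "c \<in> B" by blast
  then have "cycle_verts c \<subseteq> family_verts A \<inter> family_verts B" by blast
  with disj cycle_verts_nonempty[of c] show False by simp
qed

text \<open>
  Every way to split \<open>P\<close> into \<open>A\<close> and \<open>P - A\<close> yields the same hike, so the products differ only by
  their integer coefficients, and these cancel unless \<open>P\<close> is a single prime.
\<close>

lemma splitting_cancellation:
  assumes P: "disjoint_cycles P"
  shows "(\<Sum>A\<in>Pow P. (of_int ((- 1) ^ card A) * single (family_hike A)) *
      (of_int (int (hike_length (family_hike (P - A)))) * single (family_hike (P - A)))) =
    (\<Sum>c | c \<in> P \<and> P = {c}. of_int (int (cycle_length c)) * single (prime_hike c))"
proof -
  have fin: "finite P" using P by (simp add: disjoint_cycles_def)
  have "(\<Sum>A\<in>Pow P. (of_int ((- 1) ^ card A) * single (family_hike A)) *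
      (of_int (int (hike_length (family_hike (P - A)))) * single (family_hike (P - A)))) =
    (\<Sum>A\<in>Pow P. of_int ((- 1) ^ card A * (\<Sum>c\<in>P - A. int (cycle_length c))) * single (family_hike P))"
  proof (rule sum.cong[OF refl])
    fix A assume "A \<in> Pow P"
    then have A: "A \<subseteq> P" by blast
    then have "family_hike A * family_hike (P - A) = family_hike P"
      using family_hike_Un[of A "P - A"] P by (simp add: Un_absorb1 Un_Diff_cancel)
    moreover have "hike_length (family_hike (P - A)) = (\<Sum>c\<in>P - A. cycle_length c)"
      using P by (intro hike_length_family_hike disjoint_cycles_subset[OF P]) auto
    ultimately show "(of_int ((- 1) ^ card A) * single (family_hike A)) *
      (of_int (int (hike_length (family_hike (P - A)))) * single (family_hike (P - A))) =
      of_int ((- 1) ^ card A * (\<Sum>c\<in>P - A. int (cycle_length c))) * single (family_hike P)"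
      by (simp only: of_int_mult_of_int_mult single_mult of_nat_sum)
  qed
  also have "\<dots> = of_int (\<Sum>c | c \<in> P \<and> P = {c}. int (cycle_length c)) * single (family_hike P)"
    unfolding sum_distrib_right[symmetric] of_int_sum[symmetric] alternating_weight_sum[OF fin] ..
  also have "\<dots> = (\<Sum>c | c \<in> P \<and> P = {c}. of_int (int (cycle_length c)) * single (family_hike P))"
    unfolding of_int_sum sum_distrib_right ..
  also have "\<dots> = (\<Sum>c | c \<in> P \<and> P = {c}. of_int (int (cycle_length c)) * single (prime_hike c))"
    by (rule sum.cong) (auto simp: family_hike_singleton)
  finally show ?thesis .
qed

lemma sum_induced_subgraphs:
  assumes "pair_fin_digraph G"
  shows "(\<Sum>H | induced_subgraph H (with_proj G). f H) = (\<Sum>U\<in>Pow (pverts G). f (with_proj G \<restriction> U))"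
proof -
  interpret pair_fin_digraph G by fact
  have "bij_betw (\<lambda>U. with_proj G \<restriction> U) (Pow (pverts G)) {H. induced_subgraph H (with_proj G)}"
  proof (rule bij_betwI')
    show "(with_proj G \<restriction> U = with_proj G \<restriction> V) = (U = V)" for U V
      by (metis induce_subgraph_verts)
    show "with_proj G \<restriction> U \<in> {H. induced_subgraph H (with_proj G)}" if "U \<in> Pow (pverts G)" for U
      using that by (auto intro: induced_induce)
    show "\<exists>U\<in>Pow (pverts G). H = with_proj G \<restriction> U" if "H \<in> {H. induced_subgraph H (with_proj G)}" for H
      using that by (intro bexI[of _ "verts H"])
        (auto simp: induced_subgraph_def subgraph_def compatible_def induce_subgraph_def)
  qed
  then show ?thesis by (rule sum.reindex_bij_betw[symmetric])
qed

theorem corollary3p4: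
  fixes G :: "'v::linorder pair_pre_digraph"
  assumes "pair_fin_digraph G"
  shows "derivation (\<Sum>p\<in>primes G. single (prime_hike p)) =
    (\<Sum>H | induced_subgraph H (with_proj G).
       hike_series (ncdet (verts H) (\<lambda>i j. - adj_matrix H i j)) *
       derivation (hike_series
         (ncperm (verts (with_proj G \<restriction> (pverts G - verts H)))
           (\<lambda>i j. id_matrix i j + adj_matrix (with_proj G \<restriction> (pverts G - verts H)) i j))))"
proof -
  interpret pair_fin_digraph G by fact
  let ?V = "pverts G" and ?C = "cycle_families G"
  let ?d = "\<lambda>A. of_int ((- 1) ^ card A) * single (family_hike A) :: 'v hike series"
  let ?p = "\<lambda>B. of_int (int (hike_length (family_hike B))) * single (family_hike B) :: 'v hike series"
  have finV: "finite ?V" by (rule pair_finite_verts)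
  have finC: "finite ?C" using assms by (rule finite_cycle_families)
  have verts: "family_verts P \<subseteq> ?V" if "P \<in> ?C" for P
  proof clarify
    fix v c assume c: "c \<in> P" "v \<in> cycle_verts c"
    then have "c \<in> primes G" using that by (auto simp: cycle_families_def)
    then have "(v, successor c v) \<in> parcs G"
      using c by (simp add: mem_primes_iff[OF pair_wf_digraph_axioms])
    then show "v \<in> ?V" using arc_fst_in_verts by fastforce
  qed
  \<comment> \<open>Write the right-hand side as a sum over pairs \<open>(A, B)\<close> of families, \<open>A\<close> covering \<open>U\<close> and
    \<open>B\<close> avoiding it; \<open>U\<close> is then determined by \<open>A\<close>.\<close>
  have "(\<Sum>H | induced_subgraph H (with_proj G).
       hike_series (ncdet (verts H) (\<lambda>i j. - adj_matrix H i j)) *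
       derivation (hike_series
         (ncperm (verts (with_proj G \<restriction> (pverts G - verts H)))
           (\<lambda>i j. id_matrix i j + adj_matrix (with_proj G \<restriction> (pverts G - verts H)) i j)))) =
    (\<Sum>U\<in>Pow ?V. (\<Sum>A | A \<in> ?C \<and> family_verts A = U. ?d A) *
      (\<Sum>B | B \<in> ?C \<and> family_verts B \<subseteq> ?V - U. ?p B))"
    unfolding sum_induced_subgraphs[OF assms] induce_subgraph_verts
  proof (rule sum.cong[OF refl])
    fix U assume "U \<in> Pow ?V"
    then have U: "finite U" using finV by (blast intro: finite_subset)
    show "hike_series (ncdet U (\<lambda>i j. - adj_matrix (with_proj G \<restriction> U) i j)) *
       derivation (hike_series (ncperm (?V - U)
           (\<lambda>i j. id_matrix i j + adj_matrix (with_proj G \<restriction> (?V - U)) i j))) =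
      (\<Sum>A | A \<in> ?C \<and> family_verts A = U. ?d A) *
      (\<Sum>B | B \<in> ?C \<and> family_verts B \<subseteq> ?V - U. ?p B)"
      unfolding hike_series_ncdet[OF pair_wf_digraph_axioms U]
        hike_series_ncperm[OF assms finite_Diff[OF finV]] derivation_sum derivation_single ..
  qed
  also have "\<dots> = (\<Sum>U\<in>Pow ?V. \<Sum>A | A \<in> ?C \<and> family_verts A = U.
      \<Sum>B | B \<in> ?C \<and> family_verts B \<subseteq> ?V - family_verts A. ?d A * ?p B)"
    unfolding sum_product by (intro sum.cong) auto
  also have "\<dots> = (\<Sum>A\<in>?C. \<Sum>B | B \<in> ?C \<and> family_verts B \<subseteq> ?V - family_verts A. ?d A * ?p B)"
    by (rule sum.group) (use finV finC verts in auto)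
  also have "\<dots> = (\<Sum>(A, B)\<in>(SIGMA A:?C. {B \<in> ?C. family_verts B \<subseteq> ?V - family_verts A}). ?d A * ?p B)"
    by (rule sum.Sigma) (use finC in auto)
  \<comment> \<open>Regroup the pairs by their union.\<close>
  also have "\<dots> = (\<Sum>(P, A)\<in>(SIGMA P:?C. Pow P). ?d A * ?p (P - A))"
  proof (rule sum.reindex_bij_witness[where i = "\<lambda>(P, A). (A, P - A)" and j = "\<lambda>(A, B). (A \<union> B, A)"])
    fix x assume "x \<in> (SIGMA A:?C. {B \<in> ?C. family_verts B \<subseteq> ?V - family_verts A})"
    then obtain A B where x: "x = (A, B)" and A: "A \<in> ?C" and B: "B \<in> ?C"
      and "family_verts B \<subseteq> ?V - family_verts A" by blast
    then have disj: "family_verts A \<inter> family_verts B = {}" by blast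
    then have AB: "A \<inter> B = {}" by (rule families_disjoint)
    then have diff: "A \<union> B - A = B" by blast
    show "(case case x of (A, B) \<Rightarrow> (A \<union> B, A) of (P, A) \<Rightarrow> (A, P - A)) = x"
      by (simp add: x diff)
    have "A \<union> B \<in> ?C"
      using A B disjoint_cycles_Un[OF _ _ disj] by (simp add: cycle_families_def)
    then show "(case x of (A, B) \<Rightarrow> (A \<union> B, A)) \<in> (SIGMA P:?C. Pow P)"
      by (simp add: x)
    show "(case case x of (A, B) \<Rightarrow> (A \<union> B, A) of (P, A) \<Rightarrow> ?d A * ?p (P - A)) =
        (case x of (A, B) \<Rightarrow> ?d A * ?p B)"
      by (simp add: x diff)
  next
    fix y assume "y \<in> (SIGMA P:?C. Pow P)"
    then obtain P A where y: "y = (P, A)" and P: "P \<in> ?C" and A: "A \<subseteq> P" by blast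
    show "(case case y of (P, A) \<Rightarrow> (A, P - A) of (A, B) \<Rightarrow> (A \<union> B, A)) = y"
      using A by (auto simp: y)
    have "A \<in> ?C" "P - A \<in> ?C" using cycle_families_subset[OF P] A by auto
    moreover have "family_verts A \<inter> family_verts (P - A) = {}"
      using P A by (intro family_verts_disjoint[of P]) (auto simp: cycle_families_def)
    ultimately show "(case y of (P, A) \<Rightarrow> (A, P - A)) \<in>
        (SIGMA A:?C. {B \<in> ?C. family_verts B \<subseteq> ?V - family_verts A})"
      using verts[of "P - A"] by (auto simp: y)
  qed
  also have "\<dots> = (\<Sum>P\<in>?C. \<Sum>A\<in>Pow P. ?d A * ?p (P - A))"
    by (rule sum.Sigma[symmetric]) (use finC in \<open>auto simp: cycle_families_def disjoint_cycles_def\<close>)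
  also have "\<dots> = (\<Sum>P\<in>?C. \<Sum>c | c \<in> P \<and> P = {c}. of_int (int (cycle_length c)) * single (prime_hike c))"
    by (intro sum.cong refl splitting_cancellation) (auto simp: cycle_families_def)
  also have "\<dots> = (\<Sum>P\<in>?C. \<Sum>c | c \<in> primes G \<and> P = {c}. of_int (int (cycle_length c)) * single (prime_hike c))"
    by (intro sum.cong) (auto simp: cycle_families_def)
  also have "\<dots> = (\<Sum>c\<in>primes G. \<Sum>P | P \<in> ?C \<and> P = {c}. of_int (int (cycle_length c)) * single (prime_hike c))"
    by (rule sum.swap_restrict[OF finC finite_primes[OF assms]])
  also have "\<dots> = (\<Sum>c\<in>primes G. of_int (int (cycle_length c)) * single (prime_hike c))"
  proof (rule sum.cong[OF refl])
    fix c assume "c \<in> primes G"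
    then have "{P. P \<in> ?C \<and> P = {c}} = {{c}}"
      by (auto simp: cycle_families_def disjoint_cycles_def)
    then show "(\<Sum>P | P \<in> ?C \<and> P = {c}. of_int (int (cycle_length c)) * single (prime_hike c)) =
        of_int (int (cycle_length c)) * single (prime_hike c)" by simp
  qed
  also have "\<dots> = derivation (\<Sum>p\<in>primes G. single (prime_hike p))"
    by (simp add: derivation_sum derivation_single prime_hike.abs_eq hike_length.abs_eq)
  finally show ?thesis ..
qed

end
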